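(* Let $\mathbb{K}$ be a field and let $X,Y$ be finite simplicial complexes on the same vertex set. For a simplicial complex $Z$ write $\tilde{h}_i(Z)=\dim_{\mathbb{K}}\tilde{H}_i(Z;\mathbb{K})$. Then for every $k\geq 0$ $$\tilde{h}_{k-1}(X\cap Y)\leq \sum_{\sigma\in Y}\ \sum_{i+j=k}\tilde{h}_{i-1}(X[\sigma])\cdot \tilde{h}_{j-1}(\mathrm{lk}(Y,\sigma)).$$
   Context: For a simplicial complex $X$ on vertex set $V$ and $S\subset V$, the induced subcomplex is $X[S]=\{\sigma\in X:\sigma\subset S\}$. The void complex $\{\}$ has no faces; the empty complex $\{\emptyset\}$ has only the empty face. Every non-void complex contains $\emptyset$ as its unique $(-1)$-dimensional face; in particular the sum ranges over all faces of $Y$ including $\sigma=\emptyset$. For $A\subset V$, the star is $\mathrm{St}(X,A)=\{\tau\in X:\tau\cup A\in X\}$ and the link is $\mathrm{lk}(X,A)=\{\tau\in\mathrm{St}(X,A):\tau\cap A=\emptyset\}$ (so $\mathrm{lk}(X,A)=\{\}$ if $A\notin X$). Reduced homology conventions: $\tilde{h}_{-1}(\{\})=0$ and $\tilde{h}_{-1}(\{\emptyset\})=1$. *)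

theory Defs
  imports "HOL-Algebra.QuotRing" "Jordan_Normal_Form.VS_Connect"
begin

section \<open>Simplicial complexes\<close>

text \<open>A complex need not contain every \<open>{v}\<close> with \<open>v \<in> V\<close>, and it may be void (\<open>{}\<close>) or
  empty (\<open>{{}}\<close>).\<close>

definition simplicial_complex :: "'v set \<Rightarrow> 'v set set \<Rightarrow> bool" where
  "simplicial_complex V X \<longleftrightarrow>
     (\<forall>\<sigma>\<in>X. finite \<sigma> \<and> \<sigma> \<subseteq> V) \<and> (\<forall>\<sigma>\<in>X. \<forall>\<tau>. \<tau> \<subseteq> \<sigma> \<longrightarrow> \<tau> \<in> X)"

definition induced_subcomplex :: "'v set set \<Rightarrow> 'v set \<Rightarrow> 'v set set" where
  "induced_subcomplex X S = {\<sigma> \<in> X. \<sigma> \<subseteq> S}"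

definition star :: "'v set set \<Rightarrow> 'v set \<Rightarrow> 'v set set" where
  "star X A = {\<tau> \<in> X. \<tau> \<union> A \<in> X}"

definition link :: "'v set set \<Rightarrow> 'v set \<Rightarrow> 'v set set" where
  "link X A = {\<tau> \<in> star X A. \<tau> \<inter> A = {}}"

section \<open>Reduced simplicial homology over a field\<close>

text \<open>Simplices are oriented by one linear order of the vertices, fixed once and for all.\<close>

definition vertex_order :: "'v rel" where
  "vertex_order = (SOME r. linear_order r)"

lemma linear_order_vertex_order: "linear_order vertex_order"
proof -
  obtain r :: "'a rel" where "well_order r"
    using well_ordering by metis
  then have "linear_order r"
    by (simp add: well_order_on_def)
  then show ?thesis
    unfolding vertex_order_def by (rule someI)
qed

text \<open>The \<open>i\<close>-chains of \<open>X\<close> are the functions supported on the faces with \<open>i + 1\<close> vertices; for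
  \<open>i = -1\<close> this is the empty face of a non-void complex. The complexes in question are finite,
  hence so are the supports. The fields \<open>mult\<close> and \<open>one\<close> of a module record play no role.\<close>

definition chain_space :: "int \<Rightarrow> 'v set set \<Rightarrow> ('k::field, 'v set \<Rightarrow> 'k) module" where
  "chain_space i X =
     \<lparr>carrier = {c. \<forall>\<sigma>. c \<sigma> \<noteq> 0 \<longrightarrow> \<sigma> \<in> X \<and> int (card \<sigma>) = i + 1},
      mult = undefined, one = undefined,
      zero = (\<lambda>\<sigma>. 0), add = (\<lambda>c d \<sigma>. c \<sigma> + d \<sigma>), smult = (\<lambda>a c \<sigma>. a * c \<sigma>)\<rparr>"

text \<open>The linear extension of
  \<open>\<partial>[v\<^sub>0, \<dots>, v\<^sub>n] = (\<Sum>j\<le>n. (-1)^j [v\<^sub>0, \<dots>, v\<^sub>j\<^sub>-\<^sub>1, v\<^sub>j\<^sub>+\<^sub>1, \<dots>, v\<^sub>n])\<close> for \<open>v\<^sub>0 < \<dots> < v\<^sub>n\<close>,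
  where \<open>j\<close> is the number of vertices preceding \<open>v\<^sub>j\<close>. On \<open>0\<close>-chains it is the augmentation,
  with values in the multiples of the empty face.\<close>

definition boundary :: "('v set \<Rightarrow> 'k::field) \<Rightarrow> 'v set \<Rightarrow> 'k" where
  "boundary c \<tau> =
     (\<Sum>\<sigma> | c \<sigma> \<noteq> 0. \<Sum>v \<in> {v \<in> \<sigma>. \<sigma> - {v} = \<tau>}.
        (-1) ^ card {u \<in> \<sigma>. (u, v) \<in> vertex_order \<and> u \<noteq> v} * c \<sigma>)"

definition cycles :: "int \<Rightarrow> 'v set set \<Rightarrow> ('v set \<Rightarrow> 'k::field) set" where
  "cycles i X = {c \<in> carrier (chain_space i X). boundary c = (\<lambda>\<tau>. 0)}"

definition boundaries :: "int \<Rightarrow> 'v set set \<Rightarrow> ('v set \<Rightarrow> 'k::field) set" where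
  "boundaries i X = boundary ` carrier (chain_space (i + 1) X)"

text \<open>The vector space of cosets of \<open>W\<close> in \<open>V\<close>, in the style of \<^const>\<open>FactRing\<close>.\<close>

definition quotient_space :: "('k, 'c) module \<Rightarrow> 'c set \<Rightarrow> ('k, 'c set) module" where
  "quotient_space V W =
     \<lparr>carrier = a_rcosets\<^bsub>V\<^esub> W, mult = undefined, one = undefined,
      zero = W, add = (<+>\<^bsub>V\<^esub>), smult = (\<lambda>a C. \<Union>c\<in>C. W +>\<^bsub>V\<^esub> (a \<odot>\<^bsub>V\<^esub> c))\<rparr>"

definition reduced_homology :: "int \<Rightarrow> 'v set set \<Rightarrow> ('k::field, ('v set \<Rightarrow> 'k) set) module" where
  "reduced_homology i X =
     quotient_space (chain_space i X\<lparr>carrier := cycles i X\<rparr>) (boundaries i X)"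

definition reduced_betti :: "'k::field itself \<Rightarrow> int \<Rightarrow> 'v set set \<Rightarrow> nat" where
  "reduced_betti K i X =
     vectorspace.dim (class_ring :: 'k ring)
       (reduced_homology i X :: ('k, ('v set \<Rightarrow> 'k) set) module)"

end

theory Submission
  imports Defs "HOL-Library.Function_Algebras"
begin

text \<open>
  Consider the triples \<open>(\<alpha>, \<sigma>, \<beta>)\<close> with \<open>\<alpha> \<in> X[\<sigma>]\<close>, \<open>\<sigma> \<in> Y\<close> and \<open>\<beta> \<in> lk(Y, \<sigma>)\<close>, in degree
  \<open>|\<alpha>| + |\<beta>|\<close>. They span a complex whose differential is the simplicial boundary in \<open>\<alpha>\<close> plus the
  cubical boundary of the cube \<open>[\<sigma>, \<sigma> \<union> \<beta>]\<close>. The chain complex of \<open>X \<inter> Y\<close> is a direct summand of it,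
  up to the index shift: a simplex is sent to the signed sum of the \<open>(\<alpha>, \<alpha>, \<beta>)\<close> over its partitions
  into \<open>\<alpha>\<close> and \<open>\<beta>\<close>, and \<open>(\<alpha>, \<sigma>, {}) \<mapsto> \<alpha>\<close> is a chain map that is left inverse to this. Filtering
  by \<open>\<sigma>\<close>, the graded pieces are the tensor products of the chain complexes of \<open>X[\<sigma>]\<close> and \<open>lk(Y, \<sigma>)\<close>,
  because moving a vertex from \<open>\<beta>\<close> to \<open>\<sigma>\<close> enlarges \<open>\<sigma>\<close>. Hence the homology of the whole is at
  most the sum of the homologies of the pieces, which the Kuenneth formula computes.
\<close>

section \<open>Spaces of scalar functions\<close>

text \<open>All chains are functions into the field. With this scaling they form a
  \<open>vector_space\<close>, in which the linear algebra is done; the module records return only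
  when a dimension is read off.\<close>

definition fscale :: "'k::field \<Rightarrow> ('a \<Rightarrow> 'k) \<Rightarrow> 'a \<Rightarrow> 'k" where
  "fscale a f = (\<lambda>x. a * f x)"

lemma fscale_apply: "fscale a f x = a * f x"
  by (simp add: fscale_def)

lemma sum_fun_apply [simp]: "(\<Sum>i\<in>I. f i) x = (\<Sum>i\<in>I. f i x)"
  for f :: "'i \<Rightarrow> 'a \<Rightarrow> 'k::comm_monoid_add"
  by (induction I rule: infinite_finite_induct) auto

interpretation FS: vector_space "fscale :: 'k::field \<Rightarrow> ('a \<Rightarrow> 'k) \<Rightarrow> _"
  by unfold_locales (auto simp: fun_eq_iff fscale_def algebra_simps)

interpretation SC: vector_space "(*) :: 'k::field \<Rightarrow> 'k \<Rightarrow> 'k"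
  by unfold_locales (auto simp: algebra_simps)

declare SC.scale_scale [simp del] \<comment> \<open>this is \<open>mult.assoc\<close> read from right to left\<close>

interpretation FP: vector_space_pair "fscale :: 'k::field \<Rightarrow> ('a \<Rightarrow> 'k) \<Rightarrow> _"
    "fscale :: 'k \<Rightarrow> ('b \<Rightarrow> 'k) \<Rightarrow> _"
  by unfold_locales

interpretation FK: vector_space_pair "fscale :: 'k::field \<Rightarrow> ('a \<Rightarrow> 'k) \<Rightarrow> _"
    "(*) :: 'k \<Rightarrow> 'k \<Rightarrow> 'k"
  by unfold_locales

abbreviation fun_linear :: "(('a \<Rightarrow> 'k::field) \<Rightarrow> 'b \<Rightarrow> 'k) \<Rightarrow> bool" where
  "fun_linear \<equiv> Vector_Spaces.linear fscale fscale"

abbreviation functional :: "(('a \<Rightarrow> 'k::field) \<Rightarrow> 'k) \<Rightarrow> bool" where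
  "functional \<equiv> Vector_Spaces.linear fscale (*)"

lemma fun_linear_iff:
  "fun_linear f \<longleftrightarrow> (\<forall>x y. f (x + y) = f x + f y) \<and> (\<forall>c x. f (fscale c x) = fscale c (f x))"
  by (auto simp: Vector_Spaces.linear_iff FS.vector_space_axioms)

lemma functional_iff:
  "functional f \<longleftrightarrow> (\<forall>x y. f (x + y) = f x + f y) \<and> (\<forall>c x. f (fscale c x) = c * f x)"
  by (auto simp: Vector_Spaces.linear_iff FS.vector_space_axioms SC.vector_space_axioms)

lemma functional_comp: "functional \<phi> \<Longrightarrow> fun_linear f \<Longrightarrow> functional (\<lambda>x. \<phi> (f x))"
  by (simp add: functional_iff fun_linear_iff)

lemma fun_linear_comp: "fun_linear g \<Longrightarrow> fun_linear f \<Longrightarrow> fun_linear (\<lambda>x. g (f x))"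
  by (simp add: fun_linear_iff)

section \<open>Separating functionals and spanning sets modulo a subspace\<close>

text \<open>Then \<open>Z\<close> modulo \<open>B\<close> has dimension at most \<open>card F\<close>; in contrast to spanning sets,
  separating sets can be pulled back along linear maps.\<close>

definition separates ::
    "(('a \<Rightarrow> 'k::field) \<Rightarrow> 'k) set \<Rightarrow> ('a \<Rightarrow> 'k) set \<Rightarrow> ('a \<Rightarrow> 'k) set \<Rightarrow> bool" where
  "separates F Z B \<longleftrightarrow>
     finite F \<and> (\<forall>\<phi>\<in>F. functional \<phi>) \<and> (\<forall>z\<in>Z. (\<forall>\<phi>\<in>F. \<phi> z = 0) \<longrightarrow> z \<in> B)"

text \<open>The kernel of one functional has codimension at most one in \<open>Z\<close>, so each
  functional costs at most one generator. The induction varies \<open>Z\<close>, which shrinks to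
  that kernel.\<close>

lemma spanning_set_if_separates:
  fixes Z B :: "('a \<Rightarrow> 'k::field) set"
  assumes "separates F Z B" and "FS.subspace Z"
  shows "\<exists>A\<subseteq>Z. finite A \<and> card A \<le> card F \<and> Z \<subseteq> FS.span (A \<union> B)"
proof -
  have "finite F" using assms(1) by (simp add: separates_def)
  then show ?thesis using assms
  proof (induction F arbitrary: Z rule: finite_induct)
    case empty
    then have "Z \<subseteq> B" by (auto simp: separates_def)
    then have "Z \<subseteq> FS.span ({} \<union> B)" using FS.span_superset by fastforce
    then show ?case by (intro exI[of _ "{}"]) simp
  next
    case (insert \<phi> F)
    have \<phi>: "functional \<phi>" using insert.prems by (simp add: separates_def)
    define Z0 where "Z0 = {z \<in> Z. \<phi> z = 0}"
    have sub: "FS.subspace Z0"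
      using insert.prems(2) \<phi> unfolding Z0_def FS.subspace_def
      by (auto simp: functional_iff FK.linear_0)
    have "separates F Z0 B"
      using insert.prems(1) unfolding separates_def Z0_def by auto
    from insert.IH[OF this sub] obtain A
      where A: "A \<subseteq> Z0" "finite A" "card A \<le> card F" "Z0 \<subseteq> FS.span (A \<union> B)" by blast
    show ?case
    proof (cases "Z0 = Z")
      case True
      then show ?thesis using A insert.hyps by (intro exI[of _ A]) auto
    next
      case False
      then obtain y where y: "y \<in> Z" "\<phi> y \<noteq> 0" unfolding Z0_def by blast
      have "Z \<subseteq> FS.span (insert y A \<union> B)"
      proof
        fix z assume z: "z \<in> Z"
        have "z - fscale (\<phi> z / \<phi> y) y \<in> Z0"
          using z y insert.prems(2) \<phi>
          by (auto simp: Z0_def FS.subspace_diff FS.subspace_scale FK.linear_diff functional_iff)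
        then have 1: "z - fscale (\<phi> z / \<phi> y) y \<in> FS.span (insert y A \<union> B)"
          using A(4) FS.span_mono[of "A \<union> B" "insert y A \<union> B"] by blast
        have "fscale (\<phi> z / \<phi> y) y \<in> FS.span (insert y A \<union> B)"
          by (intro FS.span_scale FS.span_base) simp
        from FS.span_add[OF 1 this] show "z \<in> FS.span (insert y A \<union> B)" by simp
      qed
      moreover have "card (insert y A) \<le> card (insert \<phi> F)"
        using A insert.hyps by (simp add: card_insert_if)
      ultimately show ?thesis
        using A y by (intro exI[of _ "insert y A"]) (auto simp: Z0_def)
    qed
  qed
qed

text \<open>Minimality makes \<open>A\<close> independent modulo \<open>B\<close>. So
  \<open>A\<close> together with a basis \<open>C\<close> of \<open>B\<close> is independent and
  extends to a basis \<open>E\<close> of the whole function space; the \<open>\<phi> a\<close> are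
  coordinates with respect to \<open>E\<close>.\<close>

lemma dual_functionals_of_minimal_spanning_set:
  fixes Z B :: "('a \<Rightarrow> 'k::field) set"
  assumes Z: "FS.subspace Z" and B: "FS.subspace B"
    and A: "finite A" "A \<subseteq> Z" "Z \<subseteq> FS.span (A \<union> B)"
    and min: "\<And>A'. \<lbrakk>finite A'; A' \<subseteq> Z; Z \<subseteq> FS.span (A' \<union> B)\<rbrakk> \<Longrightarrow> card A \<le> card A'"
  shows "\<exists>\<phi>. (\<forall>a. functional (\<phi> a)) \<and>
    (\<forall>a\<in>A. \<forall>a'\<in>A. \<phi> a a' = (if a' = a then 1 else 0)) \<and>
    (\<forall>a\<in>A. \<forall>b\<in>B. \<phi> a b = 0) \<and> (\<forall>z\<in>Z. (\<forall>a\<in>A. \<phi> a z = 0) \<longrightarrow> z \<in> B)"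
proof -
  obtain C where C: "C \<subseteq> B" "FS.independent C" "B \<subseteq> FS.span C"
    using FS.maximal_independent_subset[of B] by blast
  have spanC: "FS.span C = B"
    using C B by (simp add: FS.span_minimal subset_antisym)
  \<comment> \<open>Otherwise \<open>A - {a}\<close> would still span \<open>Z\<close> modulo
    \<open>B\<close>, against minimality.\<close>
  have a_notin: "a \<notin> FS.span ((A - {a}) \<union> B)" if a: "a \<in> A" for a
  proof
    assume *: "a \<in> FS.span ((A - {a}) \<union> B)"
    have "A \<union> B \<subseteq> FS.span ((A - {a}) \<union> B)"
      using * FS.span_superset[of "(A - {a}) \<union> B"] by auto
    then have "FS.span (A \<union> B) \<subseteq> FS.span ((A - {a}) \<union> B)"
      by (simp add: FS.span_minimal)
    then have "card A \<le> card (A - {a})"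
      using A by (intro min) auto
    then show False using a A(1) card_Diff1_less[of A a] by auto
  qed
  have ind: "FS.independent (A0 \<union> C)" if "finite A0" "A0 \<subseteq> A" for A0
    using that
  proof (induction A0 rule: finite_induct)
    case empty
    then show ?case using C by simp
  next
    case (insert a A0)
    have "A0 \<union> C \<subseteq> (A - {a}) \<union> B" using insert C by auto
    then have "a \<notin> FS.span (A0 \<union> C)"
      using a_notin[of a] insert.prems FS.span_mono[of "A0 \<union> C" "(A - {a}) \<union> B"] by blast
    moreover have "FS.independent (A0 \<union> C)" using insert by simp
    ultimately show ?case unfolding Un_insert_left by (rule FS.independent_insertI)
  qed
  define E where "E = FS.extend_basis (A \<union> C)"
  have indAC: "FS.independent (A \<union> C)" using ind A by simp
  have E: "A \<union> C \<subseteq> E" "FS.independent E" "FS.span E = UNIV"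
    unfolding E_def
    by (rule FS.extend_basis_superset[OF indAC] FS.independent_extend_basis[OF indAC]
        FS.span_extend_basis[OF indAC])+
  define \<phi> where "\<phi> a v = FS.representation E v a" for a v
  have lin: "functional (\<phi> a)" for a
    unfolding functional_iff \<phi>_def using E by (simp add: FS.representation_add FS.representation_scale)
  have onE: "\<phi> a e = (if e = a then 1 else 0)" if "e \<in> E" for a e
    using FS.representation_basis[OF E(2) that] by (auto simp: \<phi>_def)
  have onB: "\<phi> a b = 0" if "a \<in> A" "b \<in> B" for a b
  proof -
    have "a \<notin> C"
      using a_notin[OF that(1)] C(1) FS.span_base[of a "(A - {a}) \<union> B"] by blast
    then have "\<phi> a c = 0" if "c \<in> C" for c
      using onE[of c a] E that by auto
    then show ?thesis
      using FK.linear_eq_0_on_span[OF lin[of a], of C b] that spanC by blast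
  qed
  have kerB: "z \<in> B" if z: "z \<in> Z" and 0: "\<And>a. a \<in> A \<Longrightarrow> \<phi> a z = 0" for z
  proof -
    have "A \<union> B \<subseteq> FS.span (A \<union> C)"
      using spanC FS.span_mono[of C "A \<union> C"] FS.span_superset[of "A \<union> C"] by auto
    then have zs: "z \<in> FS.span (A \<union> C)"
      using z A(3) FS.span_minimal[of "A \<union> B" "FS.span (A \<union> C)"] by auto
    \<comment> \<open>The vector \<open>z\<close> involves no basis vector outside
      \<open>A \<union> C\<close>. As its coordinates at \<open>A\<close> vanish, only vectors of
      \<open>C\<close>, hence of \<open>B\<close>, remain.\<close>
    have rep: "FS.representation (A \<union> C) z = FS.representation E z"
      using FS.representation_extend[OF E(2) zs E(1)] by simp
    have "b \<in> B" if "FS.representation E z b \<noteq> 0" for b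
      using FS.representation_ne_zero[of "A \<union> C" z b] that 0[of b] C(1) unfolding rep \<phi>_def
      by auto
    then have "(\<Sum>b | FS.representation E z b \<noteq> 0. fscale (FS.representation E z b) b) \<in> B"
      using B by (intro FS.subspace_sum FS.subspace_scale) auto
    then show ?thesis
      using FS.sum_nonzero_representation_eq[OF E(2), of z] E(3) by simp
  qed
  show ?thesis
    using lin onE onB kerB E(1) by (intro exI[of _ \<phi>]) blast
qed

section \<open>Dimension of a quotient space\<close>

context
  fixes i :: int and X :: "'v set set" and Z B :: "('v set \<Rightarrow> 'k::field) set"
  assumes Z: "FS.subspace Z" and B: "FS.subspace B" and BZ: "B \<subseteq> Z"
begin

abbreviation (input) "cs z \<equiv> (\<lambda>b. b + z) ` B"
abbreviation (input) "QS \<equiv> quotient_space (chain_space i X\<lparr>carrier := Z\<rparr>) B"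

lemma coset_eq_iff: "cs z = cs z' \<longleftrightarrow> z - z' \<in> B"
proof
  assume "cs z = cs z'"
  moreover have "0 + z \<in> cs z" using FS.subspace_0[OF B] by (rule imageI)
  ultimately obtain b where "b \<in> B" "0 + z = b + z'" by blast
  then show "z - z' \<in> B" by simp
next
  have sub: "cs x \<subseteq> cs y" if "x - y \<in> B" for x y
  proof
    fix u assume "u \<in> cs x"
    then obtain b where "b \<in> B" "u = b + x" by blast
    then have "u = (b + (x - y)) + y" "b + (x - y) \<in> B"
      using that FS.subspace_add[OF B] by auto
    then show "u \<in> cs y" by blast
  qed
  assume *: "z - z' \<in> B"
  then have "z' - z \<in> B" using FS.subspace_neg[OF B *] by simp
  with * sub show "cs z = cs z'" by blast
qed

lemma quotient_coset: "B +>\<^bsub>chain_space i X\<lparr>carrier := Z\<rparr>\<^esub> z = cs z"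
  by (auto simp: a_r_coset_def' chain_space_def plus_fun_def)

lemma quotient_carrier: "carrier QS = cs ` Z"
proof -
  have "carrier QS = (\<Union>z\<in>Z. {B +>\<^bsub>chain_space i X\<lparr>carrier := Z\<rparr>\<^esub> z})"
    by (simp add: quotient_space_def A_RCOSETS_def RCOSETS_def a_r_coset_def)
  then show ?thesis unfolding quotient_coset by auto
qed

lemma quotient_add: "cs z \<oplus>\<^bsub>QS\<^esub> cs z' = cs (z + z')"
proof -
  have "cs z \<oplus>\<^bsub>QS\<^esub> cs z' = (\<Union>c\<in>cs z. \<Union>c'\<in>cs z'. {c + c'})"
    by (simp add: quotient_space_def set_add_def set_mult_def chain_space_def plus_fun_def)
  also have "\<dots> = cs (z + z')"
  proof (intro subset_antisym subsetI)
    fix u assume "u \<in> (\<Union>c\<in>cs z. \<Union>c'\<in>cs z'. {c + c'})"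
    then obtain b b' where "b \<in> B" "b' \<in> B" "u = (b + z) + (b' + z')" by blast
    then have "b + b' \<in> B" "u = (b + b') + (z + z')"
      using FS.subspace_add[OF B] by (auto simp: add_ac)
    then show "u \<in> cs (z + z')" by blast
  next
    fix u assume "u \<in> cs (z + z')"
    then obtain b where "b \<in> B" "u = (b + z) + (0 + z')" by (auto simp: add_ac)
    then show "u \<in> (\<Union>c\<in>cs z. \<Union>c'\<in>cs z'. {c + c'})"
      using FS.subspace_0[OF B] by blast
  qed
  finally show ?thesis .
qed

lemma quotient_smult: "a \<odot>\<^bsub>QS\<^esub> cs z = cs (fscale a z)"
proof -
  have "a \<odot>\<^bsub>QS\<^esub> cs z = (\<Union>c\<in>cs z. B +>\<^bsub>chain_space i X\<lparr>carrier := Z\<rparr>\<^esub> (fscale a c))"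
    by (simp add: quotient_space_def chain_space_def fscale_def)
  also have "\<dots> = (\<Union>b\<in>B. cs (fscale a (b + z)))"
    unfolding quotient_coset by simp
  also have "\<dots> = (\<Union>b\<in>B. cs (fscale a z))"
  proof (rule SUP_cong)
    fix b assume "b \<in> B"
    then have "fscale a (b + z) - fscale a z \<in> B"
      using FS.subspace_scale[OF B] by (simp add: FS.scale_right_distrib)
    then show "cs (fscale a (b + z)) = cs (fscale a z)" by (simp only: coset_eq_iff)
  qed simp
  also have "\<dots> = cs (fscale a z)" using FS.subspace_0[OF B] by blast
  finally show ?thesis .
qed

lemma quotient_zero: "\<zero>\<^bsub>QS\<^esub> = cs 0"
  by (simp add: quotient_space_def)

lemma vectorspace_quotient: "vectorspace class_ring QS"
proof -
  note Zs = FS.subspace_add[OF Z] FS.subspace_0[OF Z] FS.subspace_scale[OF Z] FS.subspace_neg[OF Z]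
  have "abelian_group QS"
  proof (rule abelian_groupI; unfold quotient_carrier quotient_zero)
    fix x assume "x \<in> cs ` Z"
    then obtain z where z: "z \<in> Z" "x = cs z" by blast
    have "cs (- z) \<oplus>\<^bsub>QS\<^esub> x = cs 0" unfolding z quotient_add by simp
    then show "\<exists>y\<in>cs ` Z. y \<oplus>\<^bsub>QS\<^esub> x = cs 0" using Zs(4)[OF z(1)] by blast
    show "cs 0 \<oplus>\<^bsub>QS\<^esub> x = x" unfolding z quotient_add by simp
  next
    show "cs 0 \<in> cs ` Z" using Zs(2) by (rule imageI)
  next
    fix x y assume "x \<in> cs ` Z" "y \<in> cs ` Z"
    then obtain z z' where z: "z \<in> Z" "x = cs z" "z' \<in> Z" "y = cs z'" by blast
    show "x \<oplus>\<^bsub>QS\<^esub> y \<in> cs ` Z"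
      unfolding z quotient_add using Zs(1) z by blast
    show "x \<oplus>\<^bsub>QS\<^esub> y = y \<oplus>\<^bsub>QS\<^esub> x"
      unfolding z quotient_add by (simp only: add.commute)
    fix w assume "w \<in> cs ` Z"
    then obtain z'' where w: "w = cs z''" by blast
    show "x \<oplus>\<^bsub>QS\<^esub> y \<oplus>\<^bsub>QS\<^esub> w = x \<oplus>\<^bsub>QS\<^esub> (y \<oplus>\<^bsub>QS\<^esub> w)"
      unfolding z w quotient_add by (simp only: add.assoc)
  qed
  moreover have "cring (class_ring :: 'k ring)" by unfold_locales
  ultimately have "Module.module class_ring QS"
  proof (intro moduleI; (unfold quotient_carrier)?)
    fix a :: 'k and x assume "x \<in> cs ` Z"
    then obtain z where z: "z \<in> Z" "x = cs z" by blast
    show "a \<odot>\<^bsub>QS\<^esub> x \<in> cs ` Z"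
      unfolding z quotient_smult using Zs(3)[OF z(1)] by blast
    show "\<one>\<^bsub>class_ring\<^esub> \<odot>\<^bsub>QS\<^esub> x = x"
      unfolding z quotient_smult by simp
    fix b :: 'k
    show "(a \<oplus>\<^bsub>class_ring\<^esub> b) \<odot>\<^bsub>QS\<^esub> x = a \<odot>\<^bsub>QS\<^esub> x \<oplus>\<^bsub>QS\<^esub> b \<odot>\<^bsub>QS\<^esub> x"
      unfolding z quotient_smult quotient_add by (simp add: FS.scale_left_distrib)
    show "(a \<otimes>\<^bsub>class_ring\<^esub> b) \<odot>\<^bsub>QS\<^esub> x = a \<odot>\<^bsub>QS\<^esub> (b \<odot>\<^bsub>QS\<^esub> x)"
      unfolding z quotient_smult by simp
  next
    fix a :: 'k and x y assume "x \<in> cs ` Z" "y \<in> cs ` Z"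
    then obtain z z' where z: "x = cs z" "y = cs z'" by blast
    show "a \<odot>\<^bsub>QS\<^esub> (x \<oplus>\<^bsub>QS\<^esub> y) = a \<odot>\<^bsub>QS\<^esub> x \<oplus>\<^bsub>QS\<^esub> a \<odot>\<^bsub>QS\<^esub> y"
      unfolding z quotient_smult quotient_add by (simp add: FS.scale_right_distrib)
  qed
  then show ?thesis
    by (rule vectorspace.intro) unfold_locales
qed

text \<open>The bridge between spans in the quotient record and spans of functions modulo
  \<open>B\<close>. One direction pushes the subspace
  \<open>Z \<inter> FS.span (A \<union> B)\<close> forward to a submodule, the other pulls the span
  of the cosets back to a subspace.\<close>

lemma gen_set_quotient_iff:
  assumes "A \<subseteq> Z"
  shows "LinearCombinations.module.span class_ring QS (cs ` A) = carrier QS \<longleftrightarrow>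
    Z \<subseteq> FS.span (A \<union> B)"
proof -
  interpret Q: vectorspace "class_ring :: 'k ring" QS by (rule vectorspace_quotient)
  have csA: "cs ` A \<subseteq> carrier QS" unfolding quotient_carrier using assms by blast
  show ?thesis
  proof
    assume gen: "Q.span (cs ` A) = carrier QS"
    define N where "N = cs ` (Z \<inter> FS.span (A \<union> B))"
    have subsp: "FS.subspace (Z \<inter> FS.span (A \<union> B))"
      by (intro FS.subspace_inter Z FS.subspace_span)
    have "submodule class_ring N QS"
    proof (rule submodule.intro)
      show "Module.module class_ring QS" by (rule Q.module_axioms)
      show "N \<subseteq> carrier QS" unfolding quotient_carrier N_def by blast
      show "\<zero>\<^bsub>QS\<^esub> \<in> N"
        unfolding quotient_zero N_def using FS.subspace_0[OF subsp] by (rule imageI)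
    next
      fix v w assume "v \<in> N" "w \<in> N"
      then show "v \<oplus>\<^bsub>QS\<^esub> w \<in> N"
        unfolding N_def using quotient_add FS.subspace_add[OF subsp] by (elim imageE) blast
    next
      fix c v assume "v \<in> N"
      then show "c \<odot>\<^bsub>QS\<^esub> v \<in> N"
        unfolding N_def using quotient_smult FS.subspace_scale[OF subsp] by (elim imageE) blast
    qed
    moreover have "cs ` A \<subseteq> N"
      unfolding N_def using assms FS.span_superset[of "A \<union> B"] by blast
    ultimately have sub: "carrier QS \<subseteq> N" using Q.span_is_subset gen by metis
    show "Z \<subseteq> FS.span (A \<union> B)"
    proof
      fix z assume "z \<in> Z"
      then have "cs z \<in> N" using sub unfolding quotient_carrier by blast
      then obtain z' where z': "z' \<in> FS.span (A \<union> B)" "cs z = cs z'" unfolding N_def by blast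
      then have "z - z' \<in> FS.span (A \<union> B)"
        using coset_eq_iff[of z z'] FS.span_superset[of "A \<union> B"] by blast
      from FS.span_add[OF this z'(1)] show "z \<in> FS.span (A \<union> B)" by simp
    qed
  next
    assume ZAB: "Z \<subseteq> FS.span (A \<union> B)"
    interpret S: submodule "class_ring :: 'k ring" "Q.span (cs ` A)" QS
      by (rule Q.span_is_submodule[OF csA])
    have B0: "cs b = cs 0" if "b \<in> B" for b
      using that coset_eq_iff[of b 0] by simp
    have "FS.subspace {z. cs z \<in> Q.span (cs ` A)}"
    proof (rule FS.subspaceI; unfold mem_Collect_eq)
      show "cs 0 \<in> Q.span (cs ` A)" using S.zero_closed unfolding quotient_zero .
    next
      fix x y assume "cs x \<in> Q.span (cs ` A)" "cs y \<in> Q.span (cs ` A)"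
      from S.m_closed[OF this] show "cs (x + y) \<in> Q.span (cs ` A)" unfolding quotient_add .
    next
      fix c :: 'k and x assume "cs x \<in> Q.span (cs ` A)"
      with S.smult_closed[of c "cs x"] show "cs (fscale c x) \<in> Q.span (cs ` A)"
        unfolding quotient_smult by simp
    qed
    moreover have "A \<union> B \<subseteq> {z. cs z \<in> Q.span (cs ` A)}"
      using Q.in_own_span[OF csA] B0 S.zero_closed unfolding quotient_zero by auto
    ultimately have "Z \<subseteq> {z. cs z \<in> Q.span (cs ` A)}"
      using ZAB FS.span_minimal by blast
    then have "carrier QS \<subseteq> Q.span (cs ` A)" unfolding quotient_carrier by blast
    moreover have "Q.span (cs ` A) \<subseteq> carrier QS" by (rule Q.span_is_subset2[OF csA])
    ultimately show "Q.span (cs ` A) = carrier QS" by (rule subset_antisym[rotated])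
  qed
qed

lemma dim_quotient_le:
  assumes "finite A" "A \<subseteq> Z" "Z \<subseteq> FS.span (A \<union> B)"
  shows "vectorspace.dim class_ring QS \<le> card A"
proof -
  interpret Q: vectorspace "class_ring :: 'k ring" QS by (rule vectorspace_quotient)
  have "Q.dim \<le> card (cs ` A)"
    unfolding Q.dim_def
    using assms gen_set_quotient_iff[of A] quotient_carrier
    by (intro Least_le exI[of _ "cs ` A"]) auto
  also have "\<dots> \<le> card A" using assms(1) by (rule card_image_le)
  finally show ?thesis .
qed

text \<open>The dimension is a least cardinality of finite generating sets, so it is attained once
  one such set is known; \<open>A0\<close> provides it.\<close>

lemma dim_quotient_attained:
  assumes "finite A0" "A0 \<subseteq> Z" "Z \<subseteq> FS.span (A0 \<union> B)"
  obtains A where "finite A" "A \<subseteq> Z" "Z \<subseteq> FS.span (A \<union> B)"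
    "card A = vectorspace.dim class_ring QS"
proof -
  interpret Q: vectorspace "class_ring :: 'k ring" QS by (rule vectorspace_quotient)
  have "\<exists>n S. finite S \<and> card S = n \<and> S \<subseteq> carrier QS \<and> Q.span S = carrier QS"
    using assms gen_set_quotient_iff[of A0] quotient_carrier by (intro exI[of _ "cs ` A0"] exI) auto
  then have "\<exists>S. finite S \<and> card S = Q.dim \<and> S \<subseteq> carrier QS \<and> Q.span S = carrier QS"
    unfolding Q.dim_def by (rule LeastI_ex)
  then obtain S where S: "finite S" "card S = Q.dim" "S \<subseteq> cs ` Z" "Q.span S = carrier QS"
    unfolding quotient_carrier by blast
  \<comment> \<open>One representative per coset keeps the cardinality.\<close>
  then obtain A where A: "A \<subseteq> Z" "inj_on cs A" "S = cs ` A"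
    using subset_image_inj[of S cs Z] by blast
  show ?thesis
  proof (rule that)
    show "finite A" using A S(1) finite_image_iff by blast
    show "A \<subseteq> Z" by fact
    show "Z \<subseteq> FS.span (A \<union> B)" using gen_set_quotient_iff[OF A(1)] S(4) A(3) by blast
    show "card A = Q.dim" using A S(2) card_image by metis
  qed
qed

end

section \<open>Chains on a finite vertex set\<close>

definition supported :: "'a set \<Rightarrow> ('a \<Rightarrow> 'k::field) set" where
  "supported S = {c. \<forall>x. c x \<noteq> 0 \<longrightarrow> x \<in> S}"

lemma supportedD: "c \<in> supported S \<Longrightarrow> x \<notin> S \<Longrightarrow> c x = 0"
  by (auto simp: supported_def)

lemma supportedI: "(\<And>x. x \<notin> S \<Longrightarrow> c x = 0) \<Longrightarrow> c \<in> supported S"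
  by (auto simp: supported_def)

lemma subspace_supported: "FS.subspace (supported S)"
  by (rule FS.subspaceI) (auto simp: supported_def fscale_apply, metis add.right_neutral)

lemma supported_mono: "S \<subseteq> T \<Longrightarrow> supported S \<subseteq> supported T"
  by (auto simp: supported_def)

text \<open>Indexed by the number of vertices, one more than the dimension. The empty face then sits
  in degree 0 and natural numbers suffice.\<close>

definition faces :: "nat \<Rightarrow> 'v set set \<Rightarrow> 'v set set" where
  "faces k X = {\<sigma> \<in> X. card \<sigma> = k}"

definition precedes :: "'v \<Rightarrow> 'v \<Rightarrow> bool" where
  "precedes u v \<longleftrightarrow> (u, v) \<in> vertex_order \<and> u \<noteq> v"

lemma precedes_asym: "u \<noteq> v \<Longrightarrow> precedes (u :: 'a) v \<longleftrightarrow> \<not> precedes v u"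
proof -
  assume "u \<noteq> v"
  have "antisym (vertex_order :: 'a rel)" "total (vertex_order :: 'a rel)"
    using linear_order_vertex_order by (auto simp: linear_order_on_def partial_order_on_def)
  then have "(u, v) \<in> vertex_order \<or> (v, u) \<in> vertex_order"
    "\<not> ((u, v) \<in> vertex_order \<and> (v, u) \<in> vertex_order)"
    using \<open>u \<noteq> v\<close> antisymD[of vertex_order u v] unfolding total_on_def by blast+
  then show ?thesis using \<open>u \<noteq> v\<close> by (auto simp: precedes_def)
qed

text \<open>The terms at \<open>(u, v)\<close> and \<open>(v, u)\<close> cancel. The induction pairs
  them explicitly, because concluding \<open>x = 0\<close> from \<open>x = - x\<close> fails in
  characteristic 2.\<close>

lemma sum_antisymmetric_eq_0:
  fixes g :: "'a \<Rightarrow> 'a \<Rightarrow> 'k::ab_group_add"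
  assumes "finite S" and "\<And>u v. \<lbrakk>u \<in> S; v \<in> S; u \<noteq> v\<rbrakk> \<Longrightarrow> g u v = - g v u"
  shows "(\<Sum>u\<in>S. \<Sum>v\<in>S - {u}. g u v) = 0"
  using assms
proof (induction S rule: finite_induct)
  case (insert x S)
  have "(\<Sum>v\<in>insert x S - {u}. g u v) = g u x + (\<Sum>v\<in>S - {u}. g u v)" if "u \<in> S" for u
  proof -
    have "insert x S - {u} = insert x (S - {u})" using that insert.hyps by auto
    then show ?thesis using insert.hyps by simp
  qed
  then have "(\<Sum>u\<in>insert x S. \<Sum>v\<in>insert x S - {u}. g u v) =
      (\<Sum>v\<in>S. g x v) + ((\<Sum>u\<in>S. g u x) + (\<Sum>u\<in>S. \<Sum>v\<in>S - {u}. g u v))"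
    using insert.hyps by (simp add: sum.distrib)
  also have "(\<Sum>u\<in>S. \<Sum>v\<in>S - {u}. g u v) = 0"
    using insert.IH insert.prems by blast
  also have "(\<Sum>u\<in>S. g u x) = (\<Sum>u\<in>S. - g x u)"
    using insert.hyps insert.prems by (intro sum.cong refl) blast
  finally show ?case by (simp add: sum_negf)
qed simp

section \<open>Sign rules and the boundary operator on a finite ground set\<close>

locale finite_vertices =
  fixes W :: "'v set"
  assumes finite_W: "finite W"
begin

text \<open>Intersecting with \<open>W\<close> makes the sign rules hold for infinite sets as well.\<close>

definition eps :: "'v \<Rightarrow> 'v set \<Rightarrow> 'k::field" where
  "eps v \<tau> = (-1) ^ card {u \<in> \<tau> \<inter> W. precedes u v}"

text \<open>The Koszul sign, which makes the two partial differentials of a product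
  anticommute.\<close>

definition sg :: "'v set \<Rightarrow> 'k::field" where
  "sg \<tau> = (-1) ^ card (\<tau> \<inter> W)"

text \<open>The boundary read off at a face \<open>\<tau>\<close>: the sum runs over the vertices
  that can be added, a set independent of \<open>c\<close>, which makes linearity immediate.
  Agreement with \<open>boundary\<close> is shown in \<open>boundary_eq_bd\<close>.\<close>

definition bd :: "('v set \<Rightarrow> 'k::field) \<Rightarrow> 'v set \<Rightarrow> 'k" where
  "bd c \<tau> = (\<Sum>v\<in>W - \<tau>. eps v \<tau> * c (insert v \<tau>))"

lemma eps_insert:
  assumes "v \<in> W - \<tau>"
  shows "eps u (insert v \<tau>) = (if precedes v u then - eps u \<tau> else eps u \<tau>)"
proof (cases "precedes v u")
  case True
  then have "{x \<in> insert v \<tau> \<inter> W. precedes x u} = insert v {x \<in> \<tau> \<inter> W. precedes x u}"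
    using assms by auto
  moreover have "card (insert v {x \<in> \<tau> \<inter> W. precedes x u}) =
      Suc (card {x \<in> \<tau> \<inter> W. precedes x u})"
    using assms finite_W by (intro card_insert_disjoint) auto
  ultimately show ?thesis using True by (simp only: eps_def) simp
next
  case False
  then have "{x \<in> insert v \<tau> \<inter> W. precedes x u} = {x \<in> \<tau> \<inter> W. precedes x u}"
    by auto
  then show ?thesis using False by (simp only: eps_def) simp
qed

lemma sg_insert: "v \<in> W - \<tau> \<Longrightarrow> sg (insert v \<tau>) = - sg \<tau>"
  using finite_W by (simp add: sg_def)

lemma sg_square [simp]: "sg \<tau> * sg \<tau> = 1"
  by (simp add: sg_def flip: power_mult_distrib)

lemma sg_square_left [simp]: "sg \<tau> * (sg \<tau> * x) = x"
  by (simp flip: mult.assoc)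

text \<open>Exactly one of \<open>u\<close> and \<open>v\<close> precedes the other, so exactly one
  of the two signs changes when the other vertex is inserted.\<close>

lemma eps_anticommute:
  assumes "u \<in> W - \<tau>" "v \<in> W - \<tau>" "u \<noteq> v"
  shows "eps v \<tau> * eps u (insert v \<tau>) = - (eps u \<tau> * eps v (insert u \<tau>))"
proof (cases "precedes u v")
  case True
  then have "\<not> precedes v u" using precedes_asym[of u v] assms(3) by blast
  with True show ?thesis using assms by (simp add: eps_insert)
next
  case False
  then have "precedes v u" using precedes_asym[of v u] assms(3) by blast
  with False show ?thesis using assms by (simp add: eps_insert)
qed

text \<open>Inserting \<open>u\<close> and \<open>v\<close> in the two orders gives opposite signs.
  Both \<open>bd_bd\<close> and the vanishing of the square of \<open>ver\<close> are
  instances.\<close>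

lemma eps_double_sum:
  fixes h :: "'v \<Rightarrow> 'v \<Rightarrow> 'k::field"
  assumes "\<And>u v. \<lbrakk>u \<in> W - \<tau>; v \<in> W - \<tau>; u \<noteq> v\<rbrakk> \<Longrightarrow> h u v = h v u"
  shows "(\<Sum>v\<in>W - \<tau>. \<Sum>u\<in>W - insert v \<tau>. eps v \<tau> * (eps u (insert v \<tau>) * h v u)) = 0"
proof -
  have "(\<Sum>v\<in>W - \<tau>. \<Sum>u\<in>(W - \<tau>) - {v}. eps v \<tau> * (eps u (insert v \<tau>) * h v u)) = 0"
  proof (rule sum_antisymmetric_eq_0)
    fix u v assume *: "u \<in> W - \<tau>" "v \<in> W - \<tau>" "u \<noteq> v"
    show "eps u \<tau> * (eps v (insert u \<tau>) * h u v) = - (eps v \<tau> * (eps u (insert v \<tau>) * h v u))"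
      unfolding assms[OF *] mult.assoc[symmetric] eps_anticommute[OF *(2,1) *(3)[symmetric]]
      by simp
  qed (use finite_W in auto)
  moreover have "(W - \<tau>) - {v} = W - insert v \<tau>" for v by auto
  ultimately show ?thesis by simp
qed

lemma bd_bd: "bd (bd c) = 0"
proof
  fix \<tau>
  have "bd (bd c) \<tau> = (\<Sum>v\<in>W - \<tau>. \<Sum>u\<in>W - insert v \<tau>.
      eps v \<tau> * (eps u (insert v \<tau>) * c (insert u (insert v \<tau>))))"
    by (simp add: bd_def sum_distrib_left)
  also have "\<dots> = 0"
    by (rule eps_double_sum) (simp only: insert_commute)
  finally show "bd (bd c) \<tau> = 0 \<tau>" by simp
qed

lemma fun_linear_bd: "fun_linear (bd :: ('v set \<Rightarrow> 'k::field) \<Rightarrow> _)"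
  unfolding fun_linear_iff
proof (intro conjI allI ext)
  fix x y :: "'v set \<Rightarrow> 'k" and c :: 'k and \<tau>
  show "bd (x + y) \<tau> = (bd x + bd y) \<tau>"
    by (simp add: bd_def distrib_left sum.distrib)
  show "bd (fscale c x) \<tau> = fscale c (bd x) \<tau>"
    by (simp add: bd_def fscale_def sum_distrib_left mult_ac)
qed

lemmas bd_0 [simp] = FP.linear_0[OF fun_linear_bd]
  and bd_add = FP.linear_add[OF fun_linear_bd]
  and bd_diff = FP.linear_diff[OF fun_linear_bd]
  and bd_scale = FP.linear_scale[OF fun_linear_bd]

end

section \<open>Cycles, boundaries and Betti numbers of a single complex\<close>

locale complex_on = finite_vertices W for W :: "'v set" +
  fixes X :: "'v set set"
  assumes vertices: "\<sigma> \<in> X \<Longrightarrow> \<sigma> \<subseteq> W"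
    and down_closed: "\<sigma> \<in> X \<Longrightarrow> \<tau> \<subseteq> \<sigma> \<Longrightarrow> \<tau> \<in> X"
begin

lemma finite_face: "\<sigma> \<in> X \<Longrightarrow> finite \<sigma>"
  using vertices finite_W finite_subset by blast

lemma finite_X: "finite X"
  using vertices finite_W finite_subset[of X "Pow W"] by auto

lemma bd_supported:
  assumes "c \<in> supported (faces m X)"
  shows "bd c \<in> supported (faces (m - 1) X)"
proof (rule supportedI)
  fix \<tau> assume \<tau>: "\<tau> \<notin> faces (m - 1) X"
  have "c (insert v \<tau>) = 0" if "v \<in> W - \<tau>" for v
  proof (rule supportedD[OF assms], rule notI)
    assume *: "insert v \<tau> \<in> faces m X"
    then have "finite \<tau>" "\<tau> \<in> X" using finite_face down_closed[of "insert v \<tau>" \<tau>] by (auto simp: faces_def)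
    with * \<tau> that show False by (auto simp: faces_def)
  qed
  then show "bd c \<tau> = 0" by (simp add: bd_def)
qed

text \<open>For \<open>m = 0\<close> the degree \<open>m - 1\<close> in \<open>bd_supported\<close>
  truncates to 0, so the vanishing is recorded apart. It holds because no face with 0 vertices has
  the form \<open>insert v \<tau>\<close>.\<close>

lemma bd_supported_0:
  assumes "c \<in> supported (faces 0 X)"
  shows "bd c = 0"
proof
  fix \<tau>
  have "c (insert v \<tau>) = 0" if "v \<in> W - \<tau>" for v
    using finite_face by (intro supportedD[OF assms]) (fastforce simp: faces_def)
  then show "bd c \<tau> = 0 \<tau>" by (simp add: bd_def)
qed

definition cyc :: "nat \<Rightarrow> ('v set \<Rightarrow> 'k::field) set" where
  "cyc k = {c \<in> supported (faces k X). bd c = 0}"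

definition bds :: "nat \<Rightarrow> ('v set \<Rightarrow> 'k::field) set" where
  "bds k = bd ` supported (faces (Suc k) X)"

lemma subspace_cyc: "FS.subspace (cyc k)"
  using subspace_supported[of "faces k X"]
  unfolding FS.subspace_def cyc_def by (auto simp: bd_add bd_scale)

lemma subspace_bds: "FS.subspace (bds k)"
  unfolding bds_def by (rule FP.linear_subspace_image[OF fun_linear_bd subspace_supported])

lemma bds_subset_cyc: "bds k \<subseteq> cyc k"
  using bd_supported[of _ "Suc k"] by (auto simp: bds_def cyc_def bd_bd)

text \<open>For fixed \<open>\<tau>\<close>, a pair \<open>(\<sigma>, v)\<close> with
  \<open>v \<in> \<sigma>\<close> and \<open>\<sigma> - {v} = \<tau>\<close> is determined by
  \<open>v\<close>, since \<open>\<sigma> = insert v \<tau>\<close>; the vertices before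
  \<open>v\<close> in \<open>\<sigma>\<close> are those in \<open>\<tau>\<close>.\<close>

lemma boundary_eq_bd:
  assumes c: "c \<in> supported X"
  shows "boundary c = bd c"
proof
  fix \<tau>
  have fin: "finite {\<sigma>. c \<sigma> \<noteq> 0}"
    using finite_subset[OF _ finite_X, of "{\<sigma>. c \<sigma> \<noteq> 0}"] c by (auto simp: supported_def)
  have W: "\<sigma> \<subseteq> W" if "c \<sigma> \<noteq> 0" for \<sigma>
    using that c vertices by (auto simp: supported_def)
  have "boundary c \<tau> = (\<Sum>(\<sigma>, v)\<in>(SIGMA \<sigma>:{\<sigma>. c \<sigma> \<noteq> 0}. {v \<in> \<sigma>. \<sigma> - {v} = \<tau>}).
      (-1) ^ card {u \<in> \<sigma>. (u, v) \<in> vertex_order \<and> u \<noteq> v} * c \<sigma>)"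
    unfolding boundary_def using fin W finite_W
    by (subst sum.Sigma) (auto intro: finite_subset[of _ W])
  also have "\<dots> = (\<Sum>v\<in>{v \<in> W - \<tau>. c (insert v \<tau>) \<noteq> 0}. eps v \<tau> * c (insert v \<tau>))"
  proof (rule sum.reindex_bij_witness[of _ "\<lambda>v. (insert v \<tau>, v)" snd])
    fix x assume "x \<in> (SIGMA \<sigma>:{\<sigma>. c \<sigma> \<noteq> 0}. {v \<in> \<sigma>. \<sigma> - {v} = \<tau>})"
    then obtain \<sigma> v where x: "x = (\<sigma>, v)" "c \<sigma> \<noteq> 0" "v \<in> \<sigma>" "\<tau> = \<sigma> - {v}" by blast
    have ins: "insert v \<tau> = \<sigma>" using x by auto
    show "(insert (snd x) \<tau>, snd x) = x" using x ins by simp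
    show "snd x \<in> {v \<in> W - \<tau>. c (insert v \<tau>) \<noteq> 0}" using x ins W[of \<sigma>] by auto
    have "{u \<in> \<sigma>. (u, v) \<in> vertex_order \<and> u \<noteq> v} = {u \<in> \<tau> \<inter> W. precedes u v}"
      using x W[of \<sigma>] by (auto simp: precedes_def)
    then show "eps (snd x) \<tau> * c (insert (snd x) \<tau>) = (case x of (\<sigma>, v) \<Rightarrow>
        (-1) ^ card {u \<in> \<sigma>. (u, v) \<in> vertex_order \<and> u \<noteq> v} * c \<sigma>)"
      using x(1) ins by (simp add: eps_def)
  qed auto
  also have "\<dots> = bd c \<tau>"
    unfolding bd_def using finite_W by (intro sum.mono_neutral_left) auto
  finally show "boundary c \<tau> = bd c \<tau>" .
qed

lemma carrier_chain_space:
  assumes "int k = i + 1"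
  shows "carrier (chain_space i X) = supported (faces k X)"
  unfolding chain_space_def supported_def faces_def using assms by auto

lemma supported_faces_subset: "supported (faces k X) \<subseteq> supported X"
  by (rule supported_mono) (auto simp: faces_def)

lemma cycles_eq_cyc: "cycles (int k - 1) X = (cyc k :: ('v set \<Rightarrow> 'k::field) set)"
proof -
  have "boundary c = bd c" if "c \<in> supported (faces k X)" for c :: "'v set \<Rightarrow> 'k"
    using boundary_eq_bd supported_faces_subset that by blast
  then show ?thesis
    by (auto simp: cycles_def cyc_def carrier_chain_space[of k] zero_fun_def)
qed

lemma boundaries_eq_bds: "boundaries (int k - 1) X = (bds k :: ('v set \<Rightarrow> 'k::field) set)"
proof -
  have "boundary c = bd c" if "c \<in> supported (faces (Suc k) X)" for c :: "'v set \<Rightarrow> 'k"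
    using boundary_eq_bd supported_faces_subset that by blast
  then show ?thesis
    by (auto simp: boundaries_def bds_def carrier_chain_space[of "Suc k"])
qed

lemma reduced_betti_eq:
  "reduced_betti TYPE('k::field) (int k - 1) X = vectorspace.dim class_ring
     (quotient_space (chain_space (int k - 1) X\<lparr>carrier := cyc k\<rparr>) (bds k :: (_ \<Rightarrow> 'k) set))"
  unfolding reduced_betti_def reduced_homology_def cycles_eq_cyc boundaries_eq_bds ..

lemma reduced_betti_le_if_separates:
  assumes "separates F (cyc k :: ('v set \<Rightarrow> 'k::field) set) (bds k)"
  shows "reduced_betti TYPE('k) (int k - 1) X \<le> card F"
proof -
  obtain A where A: "A \<subseteq> cyc k" "finite A" "card A \<le> card F"
      "(cyc k :: ('v set \<Rightarrow> 'k) set) \<subseteq> FS.span (A \<union> bds k)"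
    using spanning_set_if_separates[OF assms subspace_cyc] by blast
  then show ?thesis
    using dim_quotient_le[OF subspace_cyc subspace_bds bds_subset_cyc A(2,1,4), of "int k - 1" X]
    by (simp add: reduced_betti_eq)
qed

text \<open>The classes of \<open>H\<close> form a basis of the homology, and the
  \<open>\<phi> a\<close> induce the dual basis on it.\<close>

definition dual_basis ::
    "nat \<Rightarrow> ('v set \<Rightarrow> 'k::field) set \<Rightarrow> (('v set \<Rightarrow> 'k) \<Rightarrow> ('v set \<Rightarrow> 'k) \<Rightarrow> 'k) \<Rightarrow> bool" where
  "dual_basis k H \<phi> \<longleftrightarrow> finite H \<and> H \<subseteq> cyc k \<and> (\<forall>a. functional (\<phi> a)) \<and>
     (\<forall>a\<in>H. \<forall>a'\<in>H. \<phi> a a' = (if a' = a then 1 else 0)) \<and>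
     (\<forall>a\<in>H. \<forall>b\<in>bds k. \<phi> a b = 0) \<and> (\<forall>z\<in>cyc k. (\<forall>a\<in>H. \<phi> a z = 0) \<longrightarrow> z \<in> bds k)"

text \<open>Evaluations at the finitely many faces separate cycles even from 0, so a finite spanning
  set exists. One whose size is the Betti number is minimal by \<open>dim_quotient_le\<close> and
  therefore has dual functionals.\<close>

lemma dual_homology_basis:
  "\<exists>(H :: ('v set \<Rightarrow> 'k::field) set) \<phi>. dual_basis k H \<phi> \<and>
     card H = reduced_betti TYPE('k) (int k - 1) X"
proof -
  let ?ev = "\<lambda>\<sigma> (c :: 'v set \<Rightarrow> 'k). c \<sigma>"
  have "separates (?ev ` X) (cyc k) (bds k)"
    unfolding separates_def
  proof (intro conjI ballI impI)
    show "finite (?ev ` X)" using finite_X by simp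
    show "functional \<phi>" if "\<phi> \<in> ?ev ` X" for \<phi>
      using that by (auto simp: functional_iff fscale_apply)
    fix z assume z: "z \<in> cyc k" and 0: "\<forall>\<phi>\<in>?ev ` X. \<phi> z = 0"
    have "z \<sigma> = 0" for \<sigma>
      using z 0 by (cases "\<sigma> \<in> X") (auto simp: cyc_def supported_def faces_def)
    then have "z = 0" by auto
    then show "z \<in> bds k" using FS.subspace_0[OF subspace_bds] by simp
  qed
  from spanning_set_if_separates[OF this subspace_cyc] obtain A0 :: "('v set \<Rightarrow> 'k) set"
    where A0: "A0 \<subseteq> cyc k" "finite A0" "cyc k \<subseteq> FS.span (A0 \<union> bds k)" by blast
  obtain A :: "('v set \<Rightarrow> 'k) set" where A: "finite A" "A \<subseteq> cyc k"
      "cyc k \<subseteq> FS.span (A \<union> bds k)" "card A = reduced_betti TYPE('k) (int k - 1) X"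
    using dim_quotient_attained[OF subspace_cyc subspace_bds bds_subset_cyc A0(2,1,3),
        of "int k - 1" X] unfolding reduced_betti_eq by blast
  have min: "card A \<le> card A'"
    if "finite A'" "A' \<subseteq> cyc k" "cyc k \<subseteq> FS.span (A' \<union> bds k)" for A' :: "('v set \<Rightarrow> 'k) set"
    unfolding A(4) reduced_betti_eq
    by (rule dim_quotient_le[OF subspace_cyc subspace_bds bds_subset_cyc that])
  have "\<exists>\<phi>. dual_basis k A \<phi>"
    unfolding dual_basis_def
    using dual_functionals_of_minimal_spanning_set[OF subspace_cyc subspace_bds A(1-3) min] A(1,2)
    by simp
  with A(4) show ?thesis by blast
qed

end

section \<open>A Kuenneth bound\<close>

context complex_on
begin

lemma separating_homology_functionals:
  obtains F :: "(('v set \<Rightarrow> 'k::field) \<Rightarrow> 'k) set"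
  where "separates F (cyc k) (bds k)" "card F \<le> reduced_betti TYPE('k) (int k - 1) X"
proof -
  obtain H and \<phi> :: "('v set \<Rightarrow> 'k) \<Rightarrow> ('v set \<Rightarrow> 'k) \<Rightarrow> 'k"
    where H: "dual_basis k H \<phi>" "card H = reduced_betti TYPE('k) (int k - 1) X"
    using dual_homology_basis[of k, where 'k='k] by blast
  show ?thesis
  proof (rule that)
    show "separates (\<phi> ` H) (cyc k) (bds k)"
      using H(1) unfolding separates_def dual_basis_def by auto
    show "card (\<phi> ` H) \<le> reduced_betti TYPE('k) (int k - 1) X"
      using H card_image_le[of H \<phi>] by (simp add: dual_basis_def)
  qed
qed

text \<open>A chain homotopy \<open>K\<close> between the identity and the projection onto a space of cycles
  representing the homology.\<close>

lemma homology_contraction: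
  obtains H :: "nat \<Rightarrow> ('v set \<Rightarrow> 'k::field) set"
    and K :: "nat \<Rightarrow> ('v set \<Rightarrow> 'k) \<Rightarrow> ('v set \<Rightarrow> 'k)"
    and \<psi> :: "nat \<Rightarrow> ('v set \<Rightarrow> 'k) \<Rightarrow> ('v set \<Rightarrow> 'k) \<Rightarrow> 'k"
  where "\<And>i. finite (H i)" "\<And>i. H i \<subseteq> cyc i"
    "\<And>i. card (H i) = reduced_betti TYPE('k) (int i - 1) X"
    "\<And>i. fun_linear (K i)" "\<And>i h. functional (\<psi> i h)"
    "\<And>i c. K i c \<in> supported (faces (Suc i) X)"
    "\<And>i h c. \<lbrakk>h \<in> H i; c \<in> supported (faces (Suc i) X)\<rbrakk> \<Longrightarrow> \<psi> i h (bd c) = 0"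
    "\<And>i c. c \<in> supported (faces i X) \<Longrightarrow>
       bd (K i c) + K (i - 1) (bd c) + (\<Sum>h\<in>H i. fscale (\<psi> i h c) h) = c"
proof -
  obtain H and \<phi> :: "nat \<Rightarrow> ('v set \<Rightarrow> 'k) \<Rightarrow> ('v set \<Rightarrow> 'k) \<Rightarrow> 'k" where
    basis: "\<And>i. dual_basis i (H i) (\<phi> i)"
    and card_H: "\<And>i. card (H i) = reduced_betti TYPE('k) (int i - 1) X"
    using dual_homology_basis[where 'k='k] by metis
  have H: "\<And>i. finite (H i)" "\<And>i. H i \<subseteq> cyc i"
    and \<phi>: "\<And>i a. functional (\<phi> i a)"
      "\<And>i a a'. \<lbrakk>a \<in> H i; a' \<in> H i\<rbrakk> \<Longrightarrow> \<phi> i a a' = (if a' = a then 1 else 0)"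
      "\<And>i a b. \<lbrakk>a \<in> H i; b \<in> bds i\<rbrakk> \<Longrightarrow> \<phi> i a b = 0"
      "\<And>i z. \<lbrakk>z \<in> cyc i; \<forall>a\<in>H i. \<phi> i a z = 0\<rbrakk> \<Longrightarrow> z \<in> bds i"
    using basis unfolding dual_basis_def by simp_all
  \<comment> \<open>Over a field, \<open>bd\<close> has a linear right inverse on its image.\<close>
  have "\<forall>i. \<exists>R :: ('v set \<Rightarrow> 'k) \<Rightarrow> ('v set \<Rightarrow> 'k). fun_linear R \<and>
      range R \<subseteq> supported (faces (Suc i) X) \<and> (\<forall>b\<in>bds i. bd (R b) = b)"
    using FP.linear_exists_right_inverse_on[OF fun_linear_bd subspace_supported]
    unfolding bds_def by blast
  then obtain R :: "nat \<Rightarrow> ('v set \<Rightarrow> 'k) \<Rightarrow> ('v set \<Rightarrow> 'k)" where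
    R: "\<And>i. fun_linear (R i)" "\<And>i c. R i c \<in> supported (faces (Suc i) X)"
      "\<And>i b. b \<in> bds i \<Longrightarrow> bd (R i b) = b"
    unfolding choice_iff by blast
  \<comment> \<open>\<open>p\<close> corrects a chain to a cycle, \<open>b\<close> removes the
    homology part of that cycle and leaves a boundary, and \<open>K\<close> lifts this boundary by
    \<open>R\<close>.\<close>
  define p where "p i c = c - R (i - 1) (bd c)" for i c
  define \<psi> where "\<psi> i h c = \<phi> i h (p i c)" for i h c
  define b where "b i c = p i c - (\<Sum>h\<in>H i. fscale (\<psi> i h c) h)" for i c
  define K where "K i c = R i (b i c)" for i c
  have lin_p: "fun_linear (p i)" for i
    unfolding fun_linear_iff p_def
    by (simp add: bd_add bd_scale FP.linear_add[OF R(1)] FP.linear_scale[OF R(1)]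
        FS.scale_right_diff_distrib)
  have lin_\<psi>: "functional (\<psi> i h)" for i h
    unfolding \<psi>_def by (rule functional_comp[OF \<phi>(1) lin_p])
  have lin_b: "fun_linear (b i)" for i
    using lin_p lin_\<psi> unfolding fun_linear_iff b_def functional_iff
    by (simp add: FS.scale_left_distrib sum.distrib FS.scale_right_diff_distrib FS.scale_sum_right)
  have R0: "R i 0 = 0" for i using FP.linear_0[OF R(1)] .
  have p_eq: "p i c = c" if "bd c = 0" for i c
    unfolding p_def that R0 by simp
  have p_cyc: "p i c \<in> cyc i" if c: "c \<in> supported (faces i X)" for i c
  proof (cases i)
    case 0
    then have "bd c = 0" using bd_supported_0 c by blast
    then show ?thesis using p_eq[of c i] c by (simp add: cyc_def)
  next
    case (Suc j)
    have "bd c \<in> bds j" using c Suc by (simp add: bds_def)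
    then have "bd (p i c) = 0" unfolding p_def Suc by (simp add: bd_diff R(3))
    moreover have "p i c \<in> supported (faces i X)"
      unfolding p_def using FS.subspace_diff[OF subspace_supported c] R(2)[of "i - 1"] Suc by simp
    ultimately show ?thesis by (simp add: cyc_def)
  qed
  have b_bds: "b i c \<in> bds i" if c: "c \<in> supported (faces i X)" for i c
  proof (rule \<phi>(4))
    show "b i c \<in> cyc i"
      unfolding b_def using H(2)
      by (intro FS.subspace_diff[OF subspace_cyc] p_cyc c FS.subspace_sum[OF subspace_cyc]
          FS.subspace_scale[OF subspace_cyc]) auto
    show "\<forall>a\<in>H i. \<phi> i a (b i c) = 0"
    proof
      fix a assume a: "a \<in> H i"
      have "\<phi> i a (b i c) = \<psi> i a c - (\<Sum>h\<in>H i. \<psi> i h c * \<phi> i a h)"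
        unfolding b_def
        by (simp add: FK.linear_diff[OF \<phi>(1)] FK.linear_sum[OF \<phi>(1)] FK.linear_scale[OF \<phi>(1)] \<psi>_def)
      also have "(\<Sum>h\<in>H i. \<psi> i h c * \<phi> i a h) = (\<Sum>h\<in>H i. if h = a then \<psi> i h c else 0)"
        using \<phi>(2)[OF a] by (intro sum.cong) auto
      also have "\<dots> = \<psi> i a c" using H(1) a by simp
      finally show "\<phi> i a (b i c) = 0" by simp
    qed
  qed
  have \<psi>_bd: "\<psi> i h (bd c) = 0" if "h \<in> H i" "c \<in> supported (faces (Suc i) X)" for i h c
    unfolding \<psi>_def p_eq[OF bd_bd] using that \<phi>(3) by (auto simp: bds_def)
  \<comment> \<open>On a boundary \<open>p\<close> is the identity and \<open>\<psi>\<close>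
    vanishes, so \<open>K\<close> reduces to \<open>R\<close>. The truncated index at
    \<open>i = 0\<close> is harmless because then \<open>bd c = 0\<close>.\<close>
  have K_bd: "K (i - 1) (bd c) = R (i - 1) (bd c)" if c: "c \<in> supported (faces i X)" for i c
  proof (cases i)
    case 0
    then have "bd c = 0" using bd_supported_0 c by blast
    then show ?thesis unfolding K_def by (simp add: FP.linear_0[OF lin_b])
  next
    case (Suc j)
    then have "\<psi> j h (bd c) = 0" if "h \<in> H j" for h using \<psi>_bd that c by simp
    then show ?thesis using Suc unfolding K_def b_def by (simp add: p_eq[OF bd_bd])
  qed
  show ?thesis
  proof (rule that[OF H card_H])
    show "fun_linear (K i)" for i
      unfolding K_def by (rule fun_linear_comp[OF R(1) lin_b])
    show "functional (\<psi> i h)" for i h by (rule lin_\<psi>)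
    show "K i c \<in> supported (faces (Suc i) X)" for i c unfolding K_def by (rule R(2))
    show "\<psi> i h (bd c) = 0" if "h \<in> H i" "c \<in> supported (faces (Suc i) X)" for i h c
      using that by (rule \<psi>_bd)
    show "bd (K i c) + K (i - 1) (bd c) + (\<Sum>h\<in>H i. fscale (\<psi> i h c) h) = c"
      if c: "c \<in> supported (faces i X)" for i c
    proof -
      have "bd (K i c) = b i c" unfolding K_def by (rule R(3)[OF b_bds[OF c]])
      then show ?thesis unfolding K_bd[OF c] by (simp add: b_def p_def)
    qed
  qed
qed

end

section \<open>The tensor product of two chain complexes\<close>

context finite_vertices
begin

definition tot2 :: "('v set \<times> 'v set \<Rightarrow> 'k::field) \<Rightarrow> 'v set \<times> 'v set \<Rightarrow> 'k" where
  "tot2 g = (\<lambda>(\<alpha>, \<beta>). sg \<beta> * bd (\<lambda>a. g (a, \<beta>)) \<alpha> + bd (\<lambda>b. g (\<alpha>, b)) \<beta>)"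

definition cells2 :: "'v set set \<Rightarrow> 'v set set \<Rightarrow> nat \<Rightarrow> ('v set \<times> 'v set) set" where
  "cells2 P Q k = {(\<alpha>, \<beta>). \<alpha> \<in> P \<and> \<beta> \<in> Q \<and> card \<alpha> + card \<beta> = k}"

lemma fun_linear_tot2: "fun_linear (tot2 :: ('v set \<times> 'v set \<Rightarrow> 'k::field) \<Rightarrow> _)"
  unfolding fun_linear_iff
proof (intro conjI allI ext; clarify)
  fix x y :: "'v set \<times> 'v set \<Rightarrow> 'k" and c :: 'k and \<alpha> \<beta>
  show "tot2 (x + y) (\<alpha>, \<beta>) = (tot2 x + tot2 y) (\<alpha>, \<beta>)"
    by (simp add: tot2_def bd_def distrib_left sum.distrib)
  show "tot2 (fscale c x) (\<alpha>, \<beta>) = fscale c (tot2 x) (\<alpha>, \<beta>)"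
    by (simp add: tot2_def bd_def fscale_def sum_distrib_left distrib_left mult_ac)
qed

text \<open>Only the first factor is contracted. Applying the homology functionals of
  \<open>P\<close> in the first slot turns a cycle \<open>g\<close> into cycles
  \<open>w i h g\<close> of \<open>Q\<close>, which are tested by functionals separating the
  homology of \<open>Q\<close>. If all tests vanish, the contraction of \<open>P\<close> and
  fillings of the \<open>w i h g\<close> assemble to a chain with boundary \<open>g\<close>.\<close>

lemma kunneth_bound:
  assumes "complex_on W P" and "complex_on W Q"
  shows "\<exists>F :: (('v set \<times> 'v set \<Rightarrow> 'k::field) \<Rightarrow> 'k) set.
    separates F {g \<in> supported (cells2 P Q k). tot2 g = 0} (tot2 ` supported (cells2 P Q (Suc k))) \<and>
    card F \<le> (\<Sum>(i, j)\<in>{(i, j). i + j = k}.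
      reduced_betti TYPE('k) (int i - 1) P * reduced_betti TYPE('k) (int j - 1) Q)"
proof -
  interpret P: complex_on W P by fact
  interpret Q: complex_on W Q by fact
  obtain H :: "nat \<Rightarrow> ('v set \<Rightarrow> 'k) set"
    and K :: "nat \<Rightarrow> ('v set \<Rightarrow> 'k) \<Rightarrow> ('v set \<Rightarrow> 'k)"
    and \<psi> :: "nat \<Rightarrow> ('v set \<Rightarrow> 'k) \<Rightarrow> ('v set \<Rightarrow> 'k) \<Rightarrow> 'k"
    where H: "\<And>i. finite (H i)" "\<And>i. H i \<subseteq> P.cyc i"
      "\<And>i. card (H i) = reduced_betti TYPE('k) (int i - 1) P"
    and K: "\<And>i. fun_linear (K i)" "\<And>i c. K i c \<in> supported (faces (Suc i) P)"
    and \<psi>: "\<And>i h. functional (\<psi> i h)"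
      "\<And>i h c. \<lbrakk>h \<in> H i; c \<in> supported (faces (Suc i) P)\<rbrakk> \<Longrightarrow> \<psi> i h (bd c) = 0"
    and contr: "\<And>i c. c \<in> supported (faces i P) \<Longrightarrow>
       bd (K i c) + K (i - 1) (bd c) + (\<Sum>h\<in>H i. fscale (\<psi> i h c) h) = c"
    by (rule P.homology_contraction[where 'k='k]) blast
  have "\<forall>j. \<exists>F :: (('v set \<Rightarrow> 'k) \<Rightarrow> 'k) set. separates F (Q.cyc j) (Q.bds j) \<and>
      card F \<le> reduced_betti TYPE('k) (int j - 1) Q"
    using Q.separating_homology_functionals[where 'k='k] by metis
  then obtain G :: "nat \<Rightarrow> (('v set \<Rightarrow> 'k) \<Rightarrow> 'k) set" where
    G: "\<And>j. separates (G j) (Q.cyc j) (Q.bds j)"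
      "\<And>j. card (G j) \<le> reduced_betti TYPE('k) (int j - 1) Q"
    unfolding choice_iff by blast
  \<comment> \<open>The condition on \<open>card \<beta>\<close> selects the bidegree
    \<open>(i, k - i)\<close>, because \<open>\<psi> i h\<close> is known to vanish on boundaries in
    degree \<open>i\<close> only.\<close>
  define w where "w i h g = (\<lambda>\<beta>. if card \<beta> = k - i then \<psi> i h (\<lambda>a. g (a, \<beta>)) else 0)"
    for i h and g :: "'v set \<times> 'v set \<Rightarrow> 'k"
  define I where "I = {(i, j). i + j = k}"
  define F where "F = (\<Union>(i, j)\<in>I. (\<lambda>(h, \<chi>) g. \<chi> (w i h g)) ` (H i \<times> G j))"
  have finI: "finite I"
    unfolding I_def by (rule finite_subset[of _ "{..k} \<times> {..k}"]) auto
  have finG: "finite (G j)" for j using G(1) by (simp add: separates_def)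
  have lin_w: "fun_linear (w i h)" for i h
  proof -
    have *: "\<psi> i h (\<lambda>a. x a + y a) = \<psi> i h x + \<psi> i h y" "\<psi> i h (\<lambda>a. c * x a) = c * \<psi> i h x" for x y c
      using FK.linear_add[OF \<psi>(1), of i h x y] FK.linear_scale[OF \<psi>(1), of i h c x]
      by (simp_all add: plus_fun_def fscale_def)
    show ?thesis
      unfolding fun_linear_iff w_def by (auto simp: fun_eq_iff fscale_apply *)
  qed
  have "card F \<le> (\<Sum>(i, j)\<in>I. card (H i) * card (G j))"
    unfolding F_def
  proof (rule order_trans[OF card_UN_le[OF finI]], rule sum_mono, clarify)
    fix i j
    have "card ((\<lambda>(h, \<chi>) g. \<chi> (w i h g)) ` (H i \<times> G j)) \<le> card (H i \<times> G j)"
      using H(1) finG by (intro card_image_le) simp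
    then show "card ((\<lambda>(h, \<chi>) g. \<chi> (w i h g)) ` (H i \<times> G j)) \<le> card (H i) * card (G j)"
      by (simp add: card_cartesian_product)
  qed
  also have "\<dots> \<le> (\<Sum>(i, j)\<in>I. reduced_betti TYPE('k) (int i - 1) P *
      reduced_betti TYPE('k) (int j - 1) Q)"
    using G(2) H(3) by (intro sum_mono) auto
  finally have card_F: "card F \<le> \<dots>" .
  have "separates F {g \<in> supported (cells2 P Q k). tot2 g = 0}
      (tot2 ` supported (cells2 P Q (Suc k)))"
    unfolding separates_def
  proof (intro conjI ballI impI)
    show "finite F" unfolding F_def using finI H(1) finG by auto
    show "functional \<phi>" if "\<phi> \<in> F" for \<phi>
      using that G(1) unfolding F_def separates_def by (auto intro!: functional_comp[OF _ lin_w])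
    fix g :: "'v set \<times> 'v set \<Rightarrow> 'k"
    assume "g \<in> {g \<in> supported (cells2 P Q k). tot2 g = 0}"
    then have g: "g \<in> supported (cells2 P Q k)" and cyc: "tot2 g = 0" by auto
    assume zero: "\<forall>\<phi>\<in>F. \<phi> g = 0"
    define s where "s \<beta> = (\<lambda>a. g (a, \<beta>))" for \<beta>
    have s: "s \<beta> \<in> supported (faces (k - card \<beta>) P)" for \<beta>
      using g by (auto simp: s_def supported_def cells2_def faces_def, metis add_diff_cancel_right')
    have s0: "s \<beta> = 0" if "\<not> (\<beta> \<in> Q \<and> card \<beta> \<le> k)" for \<beta>
      using g that by (auto simp: s_def supported_def cells2_def fun_eq_iff, metis le_add2)
    \<comment> \<open>An infinite set has \<open>card\<close> 0, so counting alone does not exclude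
      it.\<close>
    have s_inf: "s (insert v \<beta>) = 0" if "infinite \<beta>" for v \<beta>
      using that Q.finite_face[of "insert v \<beta>"] by (intro s0) auto
    \<comment> \<open>The equation \<open>tot2 g = 0\<close>, read at fixed \<open>\<beta>\<close>
      as an identity between chains on \<open>P\<close>.\<close>
    have s_bd: "(\<Sum>v\<in>W - \<beta>. fscale (eps v \<beta>) (s (insert v \<beta>))) = - fscale (sg \<beta>) (bd (s \<beta>))"
      for \<beta>
    proof
      fix \<alpha>
      have "sg \<beta> * bd (s \<beta>) \<alpha> + (\<Sum>v\<in>W - \<beta>. eps v \<beta> * s (insert v \<beta>) \<alpha>) = 0"
        using fun_cong[OF cyc, of "(\<alpha>, \<beta>)"]
        by (simp add: tot2_def s_def bd_def[of "\<lambda>b. g (\<alpha>, b)"])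
      then show "(\<Sum>v\<in>W - \<beta>. fscale (eps v \<beta>) (s (insert v \<beta>))) \<alpha> =
          (- fscale (sg \<beta>) (bd (s \<beta>))) \<alpha>"
        by (simp add: fscale_apply add_eq_0_iff)
    qed
    have w_eq: "w i h g \<beta> = (if card \<beta> = k - i then \<psi> i h (s \<beta>) else 0)" for i h \<beta>
      by (simp add: w_def s_def)
    have \<psi>0: "\<psi> i h 0 = 0" for i h by (rule FK.linear_0[OF \<psi>(1)])
    have w_cyc: "w i h g \<in> Q.cyc (k - i)" if i: "i \<le> k" and h: "h \<in> H i" for i h
    proof -
      have "w i h g \<beta> = 0" if "\<beta> \<notin> faces (k - i) Q" for \<beta>
        using that s0[of \<beta>] \<psi>0 by (auto simp: w_eq faces_def)
      then have "w i h g \<in> supported (faces (k - i) Q)" by (rule supportedI)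
      moreover have "bd (w i h g) \<beta> = 0" for \<beta>
      proof (cases "finite \<beta> \<and> Suc (card \<beta>) = k - i")
        case True
        then have "bd (w i h g) \<beta> = (\<Sum>v\<in>W - \<beta>. eps v \<beta> * \<psi> i h (s (insert v \<beta>)))"
          by (auto simp: bd_def w_eq intro!: sum.cong)
        also have "\<dots> = \<psi> i h (\<Sum>v\<in>W - \<beta>. fscale (eps v \<beta>) (s (insert v \<beta>)))"
          by (simp add: FK.linear_sum[OF \<psi>(1)] FK.linear_scale[OF \<psi>(1)])
        also have "\<dots> = - (sg \<beta> * \<psi> i h (bd (s \<beta>)))"
          unfolding s_bd by (simp add: FK.linear_neg[OF \<psi>(1)] FK.linear_scale[OF \<psi>(1)])
        also have "\<psi> i h (bd (s \<beta>)) = 0"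
        proof (rule \<psi>(2)[OF h])
          have "k - card \<beta> = Suc i" using True i by arith
          then show "s \<beta> \<in> supported (faces (Suc i) P)" using s[of \<beta>] by simp
        qed
        finally show ?thesis by simp
      next
        case False
        then have "w i h g (insert v \<beta>) = 0" if "v \<in> W - \<beta>" for v
          using that s_inf[of \<beta> v] \<psi>0 by (cases "finite \<beta>") (auto simp: w_eq)
        then show ?thesis by (simp add: bd_def)
      qed
      ultimately show ?thesis by (auto simp: Q.cyc_def)
    qed
    have "\<exists>u \<in> supported (faces (Suc (k - i)) Q). w i h g = bd u" if "i \<le> k" "h \<in> H i" for i h
    proof -
      have "\<chi> (w i h g) = 0" if "\<chi> \<in> G (k - i)" for \<chi>
        using zero \<open>i \<le> k\<close> \<open>h \<in> H i\<close> that unfolding F_def I_def by force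
      then have "w i h g \<in> Q.bds (k - i)"
        using G(1)[of "k - i"] w_cyc[OF that] by (auto simp: separates_def)
      then show ?thesis by (auto simp: Q.bds_def)
    qed
    then obtain u where u: "\<And>i h. \<lbrakk>i \<le> k; h \<in> H i\<rbrakk> \<Longrightarrow> u i h \<in> supported (faces (Suc (k - i)) Q)"
      "\<And>i h. \<lbrakk>i \<le> k; h \<in> H i\<rbrakk> \<Longrightarrow> bd (u i h) = w i h g"
      by metis
    \<comment> \<open>\<open>y1\<close> applies the contraction in the first slot,
      \<open>y2 i h\<close> is the tensor product of \<open>h\<close> with a filling of
      \<open>w i h g\<close>. By \<open>y1_eq\<close> and \<open>y2_eq\<close> the boundary of the
      sum is the left side of \<open>contr\<close>, hence \<open>g\<close>.\<close>
    define y1 where "y1 = (\<lambda>(\<alpha>, \<beta>). sg \<beta> * K (k - card \<beta>) (s \<beta>) \<alpha>)"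
    define y2 where "y2 i h = (\<lambda>(\<alpha>, \<beta>). h \<alpha> * u i h \<beta>)" for i h
    define y where "y = y1 + (\<Sum>i\<le>k. \<Sum>h\<in>H i. y2 i h)"
    have "y1 \<in> supported (cells2 P Q (Suc k))"
    proof (rule supportedI, clarify)
      fix \<alpha> \<beta> assume *: "(\<alpha>, \<beta>) \<notin> cells2 P Q (Suc k)"
      show "y1 (\<alpha>, \<beta>) = 0"
      proof (cases "\<beta> \<in> Q \<and> card \<beta> \<le> k")
        case True
        with * have "\<alpha> \<notin> faces (Suc (k - card \<beta>)) P" by (auto simp: cells2_def faces_def)
        then show ?thesis by (simp add: y1_def supportedD[OF K(2)])
      next
        case False
        then show ?thesis by (simp add: y1_def s0 FP.linear_0[OF K(1)])
      qed
    qed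
    moreover have "y2 i h \<in> supported (cells2 P Q (Suc k))" if "i \<le> k" "h \<in> H i" for i h
    proof (rule supportedI, clarify)
      fix \<alpha> \<beta> assume *: "(\<alpha>, \<beta>) \<notin> cells2 P Q (Suc k)"
      have "h \<in> supported (faces i P)" using H(2) that by (auto simp: P.cyc_def)
      moreover have "\<alpha> \<notin> faces i P \<or> \<beta> \<notin> faces (Suc (k - i)) Q"
        using * that by (auto simp: cells2_def faces_def)
      ultimately show "y2 i h (\<alpha>, \<beta>) = 0"
        using supportedD[OF u(1)[OF that]] by (auto simp: y2_def dest: supportedD)
    qed
    ultimately have y: "y \<in> supported (cells2 P Q (Suc k))"
      unfolding y_def
      by (intro FS.subspace_add[OF subspace_supported] FS.subspace_sum[OF subspace_supported]) auto
    \<comment> \<open>For \<open>v \<in> W - \<beta>\<close>, inserting \<open>v\<close> changes the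
      sign of \<open>sg \<beta>\<close>, which absorbs the minus sign in
      \<open>s_bd\<close>.\<close>
    have y1_eq: "tot2 y1 (\<alpha>, \<beta>) = bd (K (k - card \<beta>) (s \<beta>)) \<alpha> + K (k - card \<beta> - 1) (bd (s \<beta>)) \<alpha>"
      for \<alpha> \<beta>
    proof -
      have "bd (\<lambda>b. y1 (\<alpha>, b)) \<beta> = K (k - card \<beta> - 1) (bd (s \<beta>)) \<alpha>"
      proof (cases "finite \<beta>")
        case True
        then have "bd (\<lambda>b. y1 (\<alpha>, b)) \<beta> =
            (\<Sum>v\<in>W - \<beta>. - sg \<beta> * (eps v \<beta> * K (k - card \<beta> - 1) (s (insert v \<beta>)) \<alpha>))"
          by (auto simp: bd_def y1_def sg_insert intro!: sum.cong)
        also have "\<dots> = - sg \<beta> * K (k - card \<beta> - 1) (\<Sum>v\<in>W - \<beta>. fscale (eps v \<beta>) (s (insert v \<beta>))) \<alpha>"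
          by (simp add: FP.linear_sum[OF K(1)] FP.linear_scale[OF K(1)] sum_distrib_left fscale_apply)
        also have "\<dots> = K (k - card \<beta> - 1) (bd (s \<beta>)) \<alpha>"
          unfolding s_bd by (simp add: FP.linear_neg[OF K(1)] FP.linear_scale[OF K(1)] fscale_apply)
        finally show ?thesis .
      next
        case False
        then have "s \<beta> = 0" using Q.finite_face[of \<beta>] by (intro s0) auto
        moreover have "y1 (\<alpha>, insert v \<beta>) = 0" for v
          by (simp add: y1_def s_inf[OF False] FP.linear_0[OF K(1)])
        then have "bd (\<lambda>b. y1 (\<alpha>, b)) \<beta> = 0" by (simp add: bd_def)
        ultimately show ?thesis by (simp add: FP.linear_0[OF K(1)])
      qed
      moreover have "(\<lambda>a. y1 (a, \<beta>)) = fscale (sg \<beta>) (K (k - card \<beta>) (s \<beta>))"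
        by (auto simp: y1_def fscale_def)
      ultimately show ?thesis by (simp add: tot2_def bd_scale fscale_apply)
    qed
    have y2_eq: "tot2 (y2 i h) (\<alpha>, \<beta>) = w i h g \<beta> * h \<alpha>" if "i \<le> k" "h \<in> H i" for i h \<alpha> \<beta>
    proof -
      have "(\<lambda>a. y2 i h (a, \<beta>)) = fscale (u i h \<beta>) h" "(\<lambda>b. y2 i h (\<alpha>, b)) = fscale (h \<alpha>) (u i h)"
        by (auto simp: y2_def fscale_def)
      moreover have "bd h = 0" using H(2) that by (auto simp: P.cyc_def)
      ultimately show ?thesis by (simp add: tot2_def bd_scale fscale_apply u(2)[OF that])
    qed
    have "tot2 y = g"
    proof (rule ext, clarify)
      fix \<alpha> \<beta> :: "'v set"
      let ?m = "k - card \<beta>"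
      have "tot2 y (\<alpha>, \<beta>) = tot2 y1 (\<alpha>, \<beta>) + (\<Sum>i\<le>k. \<Sum>h\<in>H i. w i h g \<beta> * h \<alpha>)"
        unfolding y_def by (simp add: FP.linear_add[OF fun_linear_tot2] FP.linear_sum[OF fun_linear_tot2] y2_eq)
      \<comment> \<open>Only \<open>i = k - card \<beta>\<close> survives. If
        \<open>card \<beta> > k\<close>, the subtraction truncates to 0 and both sides vanish
        because \<open>s \<beta> = 0\<close>.\<close>
      also have "(\<Sum>i\<le>k. \<Sum>h\<in>H i. w i h g \<beta> * h \<alpha>) =
          (\<Sum>i\<le>k. if i = ?m then (\<Sum>h\<in>H i. \<psi> i h (s \<beta>) * h \<alpha>) else 0)"
      proof (rule sum.cong[OF refl])
        fix i assume "i \<in> {..k}"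
        then show "(\<Sum>h\<in>H i. w i h g \<beta> * h \<alpha>) = (if i = ?m then (\<Sum>h\<in>H i. \<psi> i h (s \<beta>) * h \<alpha>) else 0)"
          using s0[of \<beta>] \<psi>0 by (cases "card \<beta> \<le> k") (auto simp: w_eq)
      qed
      also have "\<dots> = (\<Sum>h\<in>H ?m. fscale (\<psi> ?m h (s \<beta>)) h) \<alpha>"
        by (simp add: fscale_apply)
      finally have "tot2 y (\<alpha>, \<beta>) = (bd (K ?m (s \<beta>)) + K (?m - 1) (bd (s \<beta>)) +
          (\<Sum>h\<in>H ?m. fscale (\<psi> ?m h (s \<beta>)) h)) \<alpha>"
        unfolding y1_eq by simp
      then show "tot2 y (\<alpha>, \<beta>) = g (\<alpha>, \<beta>)"
        unfolding contr[OF s] by (simp add: s_def)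
    qed
    with y show "g \<in> tot2 ` supported (cells2 P Q (Suc k))" by blast
  qed
  with card_F show ?thesis unfolding I_def by blast
qed

end

section \<open>The total complex\<close>

context finite_vertices
begin

definition hor :: "('v set \<times> 'v set \<times> 'v set \<Rightarrow> 'k::field) \<Rightarrow> 'v set \<times> 'v set \<times> 'v set \<Rightarrow> 'k" where
  "hor f = (\<lambda>(\<alpha>, \<sigma>, \<beta>). sg \<beta> * bd (\<lambda>a. f (a, \<sigma>, \<beta>)) \<alpha>)"

text \<open>The two opposite cube facets in direction \<open>v\<close>, read on coefficients:
  \<open>(\<alpha>, \<sigma>, \<beta>)\<close> with \<open>v \<in> \<sigma>\<close> is a facet of
  \<open>(\<alpha>, \<sigma> - {v}, insert v \<beta>)\<close>. As an operator acting on
  \<open>\<sigma>\<close> alone it commutes with the other shifts and with the boundary in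
  \<open>\<alpha>\<close>.\<close>

definition shift ::
    "'v \<Rightarrow> ('v set \<times> 'v set \<times> 'v set \<Rightarrow> 'k::field) \<Rightarrow> 'v set \<times> 'v set \<times> 'v set \<Rightarrow> 'k" where
  "shift v f = (\<lambda>(\<alpha>, \<sigma>, \<beta>). f (\<alpha>, \<sigma>, \<beta>) - (if v \<in> \<sigma> then f (\<alpha>, \<sigma> - {v}, \<beta>) else 0))"

text \<open>Identifying \<open>(\<sigma>, \<beta>)\<close> with the cube of all sets between \<open>\<sigma>\<close> and \<open>\<sigma> \<union> \<beta>\<close>, this is the
  cubical boundary: removing \<open>v\<close> from \<open>\<beta>\<close> gives one of the two opposite facets in direction \<open>v\<close>,
  moving \<open>v\<close> from \<open>\<beta>\<close> to \<open>\<sigma>\<close> gives the other.\<close>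

definition ver :: "('v set \<times> 'v set \<times> 'v set \<Rightarrow> 'k::field) \<Rightarrow> 'v set \<times> 'v set \<times> 'v set \<Rightarrow> 'k" where
  "ver f = (\<lambda>(\<alpha>, \<sigma>, \<beta>). \<Sum>v\<in>W - \<beta>. eps v \<beta> * shift v f (\<alpha>, \<sigma>, insert v \<beta>))"

definition tot :: "('v set \<times> 'v set \<times> 'v set \<Rightarrow> 'k::field) \<Rightarrow> 'v set \<times> 'v set \<times> 'v set \<Rightarrow> 'k" where
  "tot f = hor f + ver f"

lemma fun_linear_shift: "fun_linear (shift v :: ('v set \<times> 'v set \<times> 'v set \<Rightarrow> 'k::field) \<Rightarrow> _)"
  unfolding fun_linear_iff
proof (intro conjI allI ext; clarify)
  fix x y :: "'v set \<times> 'v set \<times> 'v set \<Rightarrow> 'k" and c :: 'k and \<alpha> \<sigma> \<beta>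
  show "shift v (x + y) (\<alpha>, \<sigma>, \<beta>) = (shift v x + shift v y) (\<alpha>, \<sigma>, \<beta>)"
    by (simp add: shift_def)
  show "shift v (fscale c x) (\<alpha>, \<sigma>, \<beta>) = fscale c (shift v x) (\<alpha>, \<sigma>, \<beta>)"
    by (simp add: shift_def fscale_def right_diff_distrib)
qed

lemma fun_linear_tot: "fun_linear (tot :: ('v set \<times> 'v set \<times> 'v set \<Rightarrow> 'k::field) \<Rightarrow> _)"
  unfolding fun_linear_iff
proof (intro conjI allI ext; clarify)
  fix x y :: "'v set \<times> 'v set \<times> 'v set \<Rightarrow> 'k" and c :: 'k and \<alpha> \<sigma> \<beta>
  have "hor (x + y) (\<alpha>, \<sigma>, \<beta>) = (hor x + hor y) (\<alpha>, \<sigma>, \<beta>)"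
    by (simp add: hor_def bd_def distrib_left sum.distrib)
  moreover have "ver (x + y) (\<alpha>, \<sigma>, \<beta>) = (ver x + ver y) (\<alpha>, \<sigma>, \<beta>)"
    by (simp add: ver_def FP.linear_add[OF fun_linear_shift] distrib_left sum.distrib)
  ultimately show "tot (x + y) (\<alpha>, \<sigma>, \<beta>) = (tot x + tot y) (\<alpha>, \<sigma>, \<beta>)"
    by (simp add: tot_def)
  have "hor (fscale c x) (\<alpha>, \<sigma>, \<beta>) = fscale c (hor x) (\<alpha>, \<sigma>, \<beta>)"
    by (simp add: hor_def bd_def fscale_def sum_distrib_left mult_ac)
  moreover have "ver (fscale c x) (\<alpha>, \<sigma>, \<beta>) = fscale c (ver x) (\<alpha>, \<sigma>, \<beta>)"
    unfolding ver_def FP.linear_scale[OF fun_linear_shift]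
    by (simp add: fscale_def sum_distrib_left mult_ac)
  ultimately show "tot (fscale c x) (\<alpha>, \<sigma>, \<beta>) = fscale c (tot x) (\<alpha>, \<sigma>, \<beta>)"
    by (simp add: tot_def fscale_def distrib_left)
qed

lemma shift_commute: "shift u (shift v f) = shift v (shift u f)"
proof (rule ext, clarify)
  fix \<alpha> \<sigma> \<beta>
  have "\<sigma> - {u} - {v} = \<sigma> - {v} - {u}" by auto
  then show "shift u (shift v f) (\<alpha>, \<sigma>, \<beta>) = shift v (shift u f) (\<alpha>, \<sigma>, \<beta>)"
    by (simp add: shift_def)
qed

lemma shift_ver:
  "shift v (ver f) (\<alpha>, \<sigma>, \<beta>) = (\<Sum>u\<in>W - \<beta>. eps u \<beta> * shift v (shift u f) (\<alpha>, \<sigma>, insert u \<beta>))"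
  by (cases "v \<in> \<sigma>") (simp_all add: shift_def[of v] ver_def right_diff_distrib sum_subtractf)

lemma shift_hor: "shift v (hor f) (\<alpha>, \<sigma>, \<beta>) = sg \<beta> * bd (\<lambda>a. shift v f (a, \<sigma>, \<beta>)) \<alpha>"
  by (cases "v \<in> \<sigma>") (simp_all add: shift_def hor_def bd_def right_diff_distrib sum_subtractf)

text \<open>\<open>hor\<close> squares to zero by \<open>bd_bd\<close>, \<open>ver\<close> by
  \<open>eps_double_sum\<close> since shifts commute, and the two anticommute because
  \<open>sg \<beta>\<close> changes sign when a vertex is inserted.\<close>

lemma tot_tot: "tot (tot f) = 0"
proof (rule ext, clarify)
  fix \<alpha> \<sigma> \<beta>
  have "hor (hor f) (\<alpha>, \<sigma>, \<beta>) = sg \<beta> * bd (fscale (sg \<beta>) (bd (\<lambda>a. f (a, \<sigma>, \<beta>)))) \<alpha>"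
    by (simp add: hor_def fscale_def)
  then have hh: "hor (hor f) (\<alpha>, \<sigma>, \<beta>) = 0"
    by (simp add: bd_scale bd_bd)
  have "ver (ver f) (\<alpha>, \<sigma>, \<beta>) = (\<Sum>v\<in>W - \<beta>. \<Sum>u\<in>W - insert v \<beta>. eps v \<beta> *
      (eps u (insert v \<beta>) * shift v (shift u f) (\<alpha>, \<sigma>, insert u (insert v \<beta>))))"
    by (simp add: ver_def[of "ver f"] shift_ver sum_distrib_left)
  also have "\<dots> = 0"
    by (rule eps_double_sum) (simp only: shift_commute insert_commute)
  finally have vv: "ver (ver f) (\<alpha>, \<sigma>, \<beta>) = 0" .
  have "hor (ver f) (\<alpha>, \<sigma>, \<beta>) = (\<Sum>x\<in>W - \<alpha>. \<Sum>v\<in>W - \<beta>.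
      sg \<beta> * (eps x \<alpha> * (eps v \<beta> * shift v f (insert x \<alpha>, \<sigma>, insert v \<beta>))))"
    by (simp add: hor_def ver_def bd_def sum_distrib_left)
  also have "\<dots> = (\<Sum>v\<in>W - \<beta>. \<Sum>x\<in>W - \<alpha>.
      sg \<beta> * (eps x \<alpha> * (eps v \<beta> * shift v f (insert x \<alpha>, \<sigma>, insert v \<beta>))))"
    by (rule sum.swap)
  also have "\<dots> = - ver (hor f) (\<alpha>, \<sigma>, \<beta>)"
    by (simp add: ver_def[of "hor f"] shift_hor bd_def sg_insert sum_distrib_left mult_ac
        flip: sum_negf)
  finally have hv: "hor (ver f) (\<alpha>, \<sigma>, \<beta>) + ver (hor f) (\<alpha>, \<sigma>, \<beta>) = 0" by simp
  have "hor (x + y) = hor x + hor y" "ver (x + y) = ver x + ver y"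
    for x y :: "'v set \<times> 'v set \<times> 'v set \<Rightarrow> 'a"
    by (auto simp: hor_def ver_def bd_def FP.linear_add[OF fun_linear_shift] distrib_left sum.distrib)
  then have "tot (tot f) (\<alpha>, \<sigma>, \<beta>) = hor (hor f) (\<alpha>, \<sigma>, \<beta>) + ver (ver f) (\<alpha>, \<sigma>, \<beta>) +
      (hor (ver f) (\<alpha>, \<sigma>, \<beta>) + ver (hor f) (\<alpha>, \<sigma>, \<beta>))"
    by (simp add: tot_def)
  then show "tot (tot f) (\<alpha>, \<sigma>, \<beta>) = 0 (\<alpha>, \<sigma>, \<beta>)" using hh vv hv by simp
qed

end

section \<open>Cells over up-closed families and the filtration by \<open>\<sigma>\<close>\<close>

locale two_complexes = finite_vertices W + X: complex_on W X + Y: complex_on W Y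
  for W :: "'v set" and X Y
begin

definition cells :: "'v set set \<Rightarrow> nat \<Rightarrow> ('v set \<times> 'v set \<times> 'v set) set" where
  "cells U k = {(\<alpha>, \<sigma>, \<beta>). \<alpha> \<in> X \<and> \<alpha> \<subseteq> \<sigma> \<and> \<sigma> \<in> U \<and> \<sigma> \<inter> \<beta> = {} \<and> \<sigma> \<union> \<beta> \<in> Y \<and>
     card \<alpha> + card \<beta> = k}"

text \<open>The differential changes \<open>\<sigma>\<close> only by adding vertices of
  \<open>\<beta>\<close>, so the cells over an up-closed family span a subcomplex.\<close>

definition up_closed :: "'v set set \<Rightarrow> bool" where
  "up_closed U \<longleftrightarrow> U \<subseteq> Y \<and> (\<forall>\<sigma>\<in>U. \<forall>\<tau>\<in>Y. \<sigma> \<subseteq> \<tau> \<longrightarrow> \<tau> \<in> U)"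

lemma cells_facet:
  assumes "v \<notin> \<alpha>" "(insert v \<alpha>, \<sigma>, \<beta>) \<in> cells U (Suc k)"
  shows "(\<alpha>, \<sigma>, \<beta>) \<in> cells U k"
  using assms X.down_closed[of "insert v \<alpha>" \<alpha>] X.finite_face[of "insert v \<alpha>"]
  by (auto simp: cells_def)

lemma cells_cube_facet:
  assumes "v \<notin> \<beta>" "(\<alpha>, \<sigma>, insert v \<beta>) \<in> cells U (Suc k)"
  shows "(\<alpha>, \<sigma>, \<beta>) \<in> cells U k"
  using assms Y.down_closed[of "\<sigma> \<union> insert v \<beta>" "\<sigma> \<union> \<beta>"] Y.finite_face[of "\<sigma> \<union> insert v \<beta>"]
  by (auto simp: cells_def)

text \<open>This is the one kind of facet that changes the middle set: \<open>\<sigma> - {v}\<close>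
  is in \<open>U\<close> and \<open>\<sigma>\<close> is in \<open>Y\<close>, so up-closedness puts
  \<open>\<sigma>\<close> into \<open>U\<close>.\<close>

lemma cells_opposite_cube_facet:
  assumes "up_closed U" "v \<notin> \<beta>" "v \<in> \<sigma>" "(\<alpha>, \<sigma> - {v}, insert v \<beta>) \<in> cells U (Suc k)"
  shows "(\<alpha>, \<sigma>, \<beta>) \<in> cells U k"
proof -
  have eq: "\<sigma> - {v} \<union> insert v \<beta> = \<sigma> \<union> \<beta>" using assms by auto
  with assms have Y: "\<sigma> \<union> \<beta> \<in> Y" by (auto simp: cells_def)
  then have "\<sigma> \<in> Y" "finite \<beta>" using Y.down_closed[of "\<sigma> \<union> \<beta>" \<sigma>] Y.finite_face by auto
  moreover have "\<sigma> - {v} \<in> U" using assms by (auto simp: cells_def)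
  ultimately have "\<sigma> \<in> U" using assms(1) by (auto simp: up_closed_def)
  then show ?thesis using assms Y \<open>finite \<beta>\<close> by (auto simp: cells_def)
qed

lemma tot_supported:
  assumes U: "up_closed U" and f: "f \<in> supported (cells U (Suc k))"
  shows "tot f \<in> supported (cells U k)"
proof (rule supportedI, clarify)
  fix \<alpha> \<sigma> \<beta> assume *: "(\<alpha>, \<sigma>, \<beta>) \<notin> cells U k"
  have "f (insert v \<alpha>, \<sigma>, \<beta>) = 0" if "v \<in> W - \<alpha>" for v
    using supportedD[OF f] cells_facet[of v \<alpha>] * that by blast
  then have "hor f (\<alpha>, \<sigma>, \<beta>) = 0" by (simp add: hor_def bd_def)
  moreover have "shift v f (\<alpha>, \<sigma>, insert v \<beta>) = 0" if v: "v \<in> W - \<beta>" for v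
  proof -
    have "f (\<alpha>, \<sigma>, insert v \<beta>) = 0"
      using supportedD[OF f] cells_cube_facet[of v \<beta>] * v by blast
    moreover have "f (\<alpha>, \<sigma> - {v}, insert v \<beta>) = 0" if "v \<in> \<sigma>"
      using supportedD[OF f] cells_opposite_cube_facet[OF U, of v \<beta> \<sigma>] * v that by blast
    ultimately show ?thesis by (simp add: shift_def)
  qed
  then have "ver f (\<alpha>, \<sigma>, \<beta>) = 0" by (simp add: ver_def)
  ultimately show "tot f (\<alpha>, \<sigma>, \<beta>) = 0" by (simp add: tot_def)
qed

lemma cells2_eq:
  assumes "\<sigma> \<in> U" "U \<subseteq> Y"
  shows "(\<alpha>, \<beta>) \<in> cells2 (induced_subcomplex X \<sigma>) (link Y \<sigma>) k \<longleftrightarrow> (\<alpha>, \<sigma>, \<beta>) \<in> cells U k"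
  using assms Y.down_closed[of "\<sigma> \<union> \<beta>" \<beta>]
  by (auto simp: cells2_def cells_def induced_subcomplex_def link_def star_def Un_commute Int_commute)

text \<open>Adding a minimal element \<open>\<sigma>\<close> to an up-closed family enlarges the total complex by the
  tensor product of the chain complexes of \<open>X[\<sigma>]\<close> and of the link of \<open>\<sigma>\<close>.\<close>

lemma filtration_bound:
  assumes "up_closed U"
  shows "\<exists>F :: (('v set \<times> 'v set \<times> 'v set \<Rightarrow> 'k::field) \<Rightarrow> 'k) set.
    separates F {f \<in> supported (cells U k). tot f = 0} (tot ` supported (cells U (Suc k))) \<and>
    card F \<le> (\<Sum>\<sigma>\<in>U. \<Sum>(i, j)\<in>{(i, j). i + j = k}.
      reduced_betti TYPE('k) (int i - 1) (induced_subcomplex X \<sigma>) *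
      reduced_betti TYPE('k) (int j - 1) (link Y \<sigma>))"
proof -
  define n where "n \<sigma> = (\<Sum>(i, j)\<in>{(i, j). i + j = k}.
      reduced_betti TYPE('k) (int i - 1) (induced_subcomplex X \<sigma>) *
      reduced_betti TYPE('k) (int j - 1) (link Y \<sigma>))" for \<sigma>
  have "finite U" using assms finite_subset[OF _ Y.finite_X] by (simp add: up_closed_def)
  then have "\<exists>F :: (('v set \<times> 'v set \<times> 'v set \<Rightarrow> 'k::field) \<Rightarrow> 'k) set.
    separates F {f \<in> supported (cells U k). tot f = 0} (tot ` supported (cells U (Suc k))) \<and>
    card F \<le> (\<Sum>\<sigma>\<in>U. n \<sigma>)"
    using assms
  proof (induction U rule: finite_psubset_induct)
    case (psubset U)
    show ?case
    proof (cases "U = {}")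
      case True
      have "f = tot 0 \<and> 0 \<in> supported (cells U (Suc k))"
        if "f \<in> supported (cells U k)" for f :: "'v set \<times> 'v set \<times> 'v set \<Rightarrow> 'k"
        using that True FP.linear_0[OF fun_linear_tot] FS.subspace_0[OF subspace_supported]
        by (auto simp: supported_def cells_def fun_eq_iff)
      then show ?thesis by (intro exI[of _ "{}"]) (auto simp: separates_def)
    next
      case False
      \<comment> \<open>Minimality serves twice: it keeps \<open>?U\<close> up-closed, and it makes
        \<open>slice\<close> below a chain map.\<close>
      obtain \<sigma> where \<sigma>: "\<sigma> \<in> U" and min: "\<And>\<tau>. \<tau> \<in> U \<Longrightarrow> \<tau> \<subseteq> \<sigma> \<Longrightarrow> \<sigma> = \<tau>"
        using finite_has_minimal[OF psubset.hyps False] by blast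
      let ?U = "U - {\<sigma>}"
      let ?P = "induced_subcomplex X \<sigma>" and ?Q = "link Y \<sigma>"
      have UY: "U \<subseteq> Y" using psubset.prems by (simp add: up_closed_def)
      have up: "up_closed ?U"
        unfolding up_closed_def
      proof (intro conjI ballI impI)
        fix \<tau> \<rho> assume \<tau>: "\<tau> \<in> ?U" "\<rho> \<in> Y" "\<tau> \<subseteq> \<rho>"
        then have "\<rho> \<in> U" using psubset.prems by (auto simp: up_closed_def)
        moreover have "\<rho> \<noteq> \<sigma>" using \<tau> min[of \<tau>] by auto
        ultimately show "\<rho> \<in> ?U" by simp
      qed (use UY in auto)
      have mono: "supported (cells ?U m) \<subseteq> supported (cells U m)" for m
        by (rule supported_mono) (auto simp: cells_def)
      obtain F0 :: "(('v set \<times> 'v set \<times> 'v set \<Rightarrow> 'k) \<Rightarrow> 'k) set" where F0: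
        "separates F0 {f \<in> supported (cells ?U k). tot f = 0} (tot ` supported (cells ?U (Suc k)))"
        "card F0 \<le> (\<Sum>\<sigma>\<in>?U. n \<sigma>)"
        using psubset.IH[OF _ up] \<sigma> by blast
      have "complex_on W ?P"
        using X.vertices X.down_closed by unfold_locales (auto simp: induced_subcomplex_def)
      moreover have "complex_on W ?Q"
      proof
        fix \<beta> \<tau> assume "\<beta> \<in> ?Q" "\<tau> \<subseteq> \<beta>"
        then show "\<tau> \<in> ?Q"
          using Y.down_closed[of \<beta> \<tau>] Y.down_closed[of "\<beta> \<union> \<sigma>" "\<tau> \<union> \<sigma>"]
          by (auto simp: link_def star_def)
      qed (use Y.vertices in \<open>auto simp: link_def star_def\<close>)
      ultimately obtain F1 :: "(('v set \<times> 'v set \<Rightarrow> 'k) \<Rightarrow> 'k) set" where F1: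
        "separates F1 {g \<in> supported (cells2 ?P ?Q k). tot2 g = 0}
          (tot2 ` supported (cells2 ?P ?Q (Suc k)))" "card F1 \<le> n \<sigma>"
        using kunneth_bound[of ?P ?Q k, where 'k='k] unfolding n_def by blast
      \<comment> \<open>\<open>slice\<close> projects onto the graded piece at
        \<open>\<sigma>\<close>, with the chains over \<open>?U\<close> as kernel.
        \<open>emb\<close> is a linear right inverse of it that need not be a chain map.\<close>
      define slice where "slice f = (\<lambda>(\<alpha>, \<beta>). f (\<alpha>, \<sigma>, \<beta>))"
        for f :: "'v set \<times> 'v set \<times> 'v set \<Rightarrow> 'k"
      define emb where "emb g = (\<lambda>(\<alpha>, \<tau>, \<beta>). if \<tau> = \<sigma> then g (\<alpha>, \<beta>) else 0)"
        for g :: "'v set \<times> 'v set \<Rightarrow> 'k"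
      have lin_slice: "fun_linear slice" and lin_emb: "fun_linear emb"
        by (auto simp: fun_linear_iff slice_def emb_def fun_eq_iff fscale_apply)
      have slice_emb: "slice (emb g) = g" for g by (auto simp: slice_def emb_def)
      have slice_supp: "slice f \<in> supported (cells2 ?P ?Q m)" if "f \<in> supported (cells U m)" for f m
        using that cells2_eq[OF \<sigma> UY] by (auto simp: slice_def supported_def)
      have emb_supp: "emb g \<in> supported (cells U m)" if "g \<in> supported (cells2 ?P ?Q m)" for g m
        using that cells2_eq[OF \<sigma> UY] by (auto simp: emb_def supported_def)
      \<comment> \<open>By minimality no cell over \<open>U\<close> has middle set
        \<open>\<sigma> - {v}\<close> with \<open>v \<in> \<sigma>\<close>. The second term of
        \<open>shift\<close> therefore vanishes, and \<open>ver\<close> becomes the boundary in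
        \<open>\<beta>\<close>.\<close>
      have slice_tot: "slice (tot f) = tot2 (slice f)" if f: "f \<in> supported (cells U m)" for f m
      proof (rule ext, clarify)
        fix \<alpha> \<beta>
        have "f (\<alpha>, \<sigma> - {v}, insert v \<beta>) = 0" if "v \<in> \<sigma>" for v
          using that min[of "\<sigma> - {v}"] by (intro supportedD[OF f]) (auto simp: cells_def)
        then have "shift v f (\<alpha>, \<sigma>, insert v \<beta>) = f (\<alpha>, \<sigma>, insert v \<beta>)" for v
          by (simp add: shift_def)
        then show "slice (tot f) (\<alpha>, \<beta>) = tot2 (slice f) (\<alpha>, \<beta>)"
          by (simp add: slice_def tot_def tot2_def hor_def ver_def bd_def)
      qed
      have in_U': "f \<in> supported (cells ?U m)" if "f \<in> supported (cells U m)" "slice f = 0" for f m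
      proof (rule supportedI, clarify)
        fix \<alpha> \<tau> \<beta> assume "(\<alpha>, \<tau>, \<beta>) \<notin> cells ?U m"
        then show "f (\<alpha>, \<tau>, \<beta>) = 0"
          using supportedD[OF that(1), of "(\<alpha>, \<tau>, \<beta>)"] fun_cong[OF that(2), of "(\<alpha>, \<beta>)"]
          by (cases "\<tau> = \<sigma>") (auto simp: cells_def slice_def)
      qed
      obtain R :: "('v set \<times> 'v set \<Rightarrow> 'k) \<Rightarrow> _" where R: "fun_linear R" "range R \<subseteq> supported (cells2 ?P ?Q (Suc k))"
          "\<And>b. b \<in> tot2 ` supported (cells2 ?P ?Q (Suc k)) \<Longrightarrow> tot2 (R b) = b"
        using FP.linear_exists_right_inverse_on[OF fun_linear_tot2
            subspace_supported[of "cells2 ?P ?Q (Suc k)"]] by blast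
      \<comment> \<open>\<open>r f\<close> differs from \<open>f\<close> by a boundary. When
        \<open>slice f\<close> is a boundary, \<open>r f\<close> is supported over
        \<open>?U\<close>, where \<open>F0\<close> applies. As \<open>r\<close> is linear on all
        functions, the members of \<open>F0\<close> can be pulled back along it.\<close>
      define lift where "lift f = emb (R (slice f))" for f
      define r where "r f = f - tot (lift f)" for f
      have lin_lift: "fun_linear lift"
        unfolding lift_def by (rule fun_linear_comp[OF lin_emb fun_linear_comp[OF R(1) lin_slice]])
      have lin_r: "fun_linear r"
        using fun_linear_comp[OF fun_linear_tot lin_lift] unfolding r_def fun_linear_iff
        by (simp add: FS.scale_right_diff_distrib)
      have lift_supp: "lift f \<in> supported (cells U (Suc k))" for f
        unfolding lift_def using R(2) by (intro emb_supp) blast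
      define F where "F = (\<lambda>\<phi> f. \<phi> (r f)) ` F0 \<union> (\<lambda>\<phi> f. \<phi> (slice f)) ` F1"
      have "separates F {f \<in> supported (cells U k). tot f = 0} (tot ` supported (cells U (Suc k)))"
        unfolding separates_def
      proof (intro conjI ballI impI)
        show "finite F" using F0(1) F1(1) by (simp add: F_def separates_def)
        show "functional \<phi>" if "\<phi> \<in> F" for \<phi>
          using that F0(1) F1(1) unfolding F_def separates_def
          by (auto intro!: functional_comp[OF _ lin_r] functional_comp[OF _ lin_slice])
        fix f :: "'v set \<times> 'v set \<times> 'v set \<Rightarrow> 'k"
        assume "f \<in> {f \<in> supported (cells U k). tot f = 0}"
        then have f: "f \<in> supported (cells U k)" "tot f = 0" by auto
        assume zero: "\<forall>\<phi>\<in>F. \<phi> f = 0"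
        have zero0: "\<forall>\<phi>\<in>F0. \<phi> (r f) = 0" and zero1: "\<forall>\<phi>\<in>F1. \<phi> (slice f) = 0"
          using zero unfolding F_def ball_Un ball_simps by (rule conjunct1, rule conjunct2)
        have "tot2 (slice f) = 0"
          using slice_tot[OF f(1)] f(2) FP.linear_0[OF lin_slice] by simp
        then have "slice f \<in> tot2 ` supported (cells2 ?P ?Q (Suc k))"
          using F1(1) zero1 slice_supp[OF f(1)] unfolding separates_def by blast
        then have "slice (tot (lift f)) = slice f"
          using slice_tot[OF lift_supp] R(3) by (simp add: lift_def slice_emb)
        then have "slice (r f) = 0"
          unfolding r_def by (simp add: FP.linear_diff[OF lin_slice])
        moreover have "r f \<in> supported (cells U k)"
          unfolding r_def
          by (rule FS.subspace_diff[OF subspace_supported f(1) tot_supported[OF psubset.prems lift_supp]])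
        ultimately have "r f \<in> supported (cells ?U k)" by (intro in_U')
        moreover have "tot (r f) = 0"
          unfolding r_def by (simp add: FP.linear_diff[OF fun_linear_tot] f(2) tot_tot)
        ultimately have "r f \<in> tot ` supported (cells ?U (Suc k))"
          using F0(1) zero0 unfolding separates_def by blast
        then obtain y where y: "y \<in> supported (cells ?U (Suc k))" "r f = tot y" by blast
        have "f = tot (y + lift f)"
          using y(2) unfolding r_def by (simp add: FP.linear_add[OF fun_linear_tot] algebra_simps)
        moreover have "y + lift f \<in> supported (cells U (Suc k))"
          using y(1) mono lift_supp by (intro FS.subspace_add[OF subspace_supported]) auto
        ultimately show "f \<in> tot ` supported (cells U (Suc k))" by blast
      qed
      moreover have "card F \<le> (\<Sum>\<sigma>\<in>U. n \<sigma>)"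
      proof -
        have "card F \<le> card F0 + card F1"
          unfolding F_def using F0(1) F1(1)
          by (intro order_trans[OF card_Un_le] add_mono card_image_le) (auto simp: separates_def)
        also have "\<dots> \<le> (\<Sum>\<sigma>\<in>U. n \<sigma>)"
          using F0(2) F1(2) sum.remove[OF psubset.hyps \<sigma>, of n] by simp
        finally show ?thesis .
      qed
      ultimately show ?thesis by blast
    qed
  qed
  then show ?thesis unfolding n_def .
qed

end

section \<open>Embedding the chains of the intersection\<close>

context finite_vertices
begin

text \<open>This is \<open>-1\<close> to the number of pairs \<open>u \<in> \<alpha>\<close>,
  \<open>v \<in> \<beta>\<close> in \<open>W\<close> with \<open>u\<close> preceding
  \<open>v\<close>: the sign of sorting the vertices of \<open>\<beta>\<close> followed by those of
  \<open>\<alpha>\<close>.\<close>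

definition eta :: "'v set \<Rightarrow> 'v set \<Rightarrow> 'k::field" where
  "eta \<alpha> \<beta> = (\<Prod>v\<in>\<beta> \<inter> W. eps v \<alpha>)"

lemma eps_prod: "eps v \<tau> = (\<Prod>u\<in>\<tau> \<inter> W. if precedes u v then - 1 else 1)"
proof -
  have "{x \<in> \<tau> \<inter> W. precedes x v} = (\<tau> \<inter> W) \<inter> {u. precedes u v}" by auto
  then show ?thesis
    unfolding eps_def using finite_W by (simp add: prod.If_cases)
qed

lemma eps_union: "\<alpha> \<inter> \<beta> = {} \<Longrightarrow> eps v (\<alpha> \<union> \<beta>) = eps v \<alpha> * eps v \<beta>"
  unfolding eps_prod Int_Un_distrib2 using finite_W by (intro prod.union_disjoint) auto

lemma eta_insert_right: "v \<in> W - \<beta> \<Longrightarrow> eta \<alpha> (insert v \<beta>) = eps v \<alpha> * eta \<alpha> \<beta>"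
  unfolding eta_def using finite_W by simp

text \<open>Each \<open>x \<in> \<beta> \<inter> W\<close> either precedes \<open>v\<close> or is
  preceded by it, and \<open>sg \<beta>\<close> exchanges the two counts. The cancellation in
  \<open>tot_sub\<close> rests on this identity.\<close>

lemma eta_insert_left:
  assumes v: "v \<in> W - \<alpha>" "v \<notin> \<beta>"
  shows "sg \<beta> * eta (insert v \<alpha>) \<beta> = eps v \<beta> * eta \<alpha> \<beta>"
proof -
  have "sg \<beta> * eta (insert v \<alpha>) \<beta> = (\<Prod>x\<in>\<beta> \<inter> W. - 1 * eps x (insert v \<alpha>))"
    unfolding eta_def sg_def by (simp only: prod.distrib prod_constant)
  also have "\<dots> = (\<Prod>x\<in>\<beta> \<inter> W. (if precedes x v then - 1 else 1) * eps x \<alpha>)"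
  proof (rule prod.cong[OF refl])
    fix x assume "x \<in> \<beta> \<inter> W"
    then have "precedes x v \<longleftrightarrow> \<not> precedes v x" using v precedes_asym[of x v] by blast
    then show "- 1 * eps x (insert v \<alpha>) = (if precedes x v then - 1 else 1) * eps x \<alpha>"
      using v by (auto simp: eps_insert)
  qed
  also have "\<dots> = eps v \<beta> * eta \<alpha> \<beta>"
    unfolding eta_def eps_prod[of v] by (rule prod.distrib)
  finally show ?thesis .
qed

text \<open>A simplex is sent to the signed sum of all \<open>(\<alpha>, \<alpha>, \<beta>)\<close> such that \<open>\<alpha>\<close> and \<open>\<beta>\<close> partition it;
  the sign is that of the shuffle.\<close>

definition sub :: "('v set \<Rightarrow> 'k::field) \<Rightarrow> 'v set \<times> 'v set \<times> 'v set \<Rightarrow> 'k" where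
  "sub c = (\<lambda>(\<alpha>, \<sigma>, \<beta>). if \<sigma> = \<alpha> \<and> \<alpha> \<inter> \<beta> = {} then eta \<alpha> \<beta> * c (\<alpha> \<union> \<beta>) else 0)"

lemma fun_linear_sub: "fun_linear (sub :: ('v set \<Rightarrow> 'k::field) \<Rightarrow> _)"
  unfolding fun_linear_iff
proof (intro conjI allI ext; clarify)
  fix x y :: "'v set \<Rightarrow> 'k" and c :: 'k and \<alpha> \<sigma> \<beta>
  show "sub (x + y) (\<alpha>, \<sigma>, \<beta>) = (sub x + sub y) (\<alpha>, \<sigma>, \<beta>)"
    by (simp add: sub_def distrib_left)
  show "sub (fscale c x) (\<alpha>, \<sigma>, \<beta>) = fscale c (sub x) (\<alpha>, \<sigma>, \<beta>)"
    by (simp add: sub_def fscale_def mult_ac)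
qed

text \<open>At \<open>\<sigma> = \<alpha>\<close> only \<open>ver\<close> contributes and yields the
  boundary of \<open>c\<close>. At \<open>\<sigma> = insert v \<alpha>\<close> the contributions of
  \<open>hor\<close> and \<open>ver\<close> cancel, and elsewhere there are none.\<close>

lemma tot_sub:
  fixes c :: "'v set \<Rightarrow> 'k::field"
  shows "tot (sub c) = sub (bd c)"
proof (rule ext, clarify)
  fix \<alpha> \<sigma> \<beta> :: "'v set"
  consider "\<sigma> = \<alpha>" | v where "v \<notin> \<alpha>" "\<sigma> = insert v \<alpha>"
    | "\<sigma> \<noteq> \<alpha>" "\<And>v. v \<notin> \<alpha> \<Longrightarrow> \<sigma> \<noteq> insert v \<alpha>" by blast
  then show "tot (sub c) (\<alpha>, \<sigma>, \<beta>) = sub (bd c) (\<alpha>, \<sigma>, \<beta>)"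
  proof cases
    case 1
    have "sub c (insert v \<alpha>, \<sigma>, \<beta>) = 0" if "v \<in> W - \<alpha>" for v
      using that 1 by (auto simp: sub_def)
    then have hor: "hor (sub c) (\<alpha>, \<sigma>, \<beta>) = 0" by (simp add: hor_def bd_def)
    have shift: "shift v (sub c) (\<alpha>, \<sigma>, insert v \<beta>) =
        (if v \<notin> \<alpha> \<and> \<alpha> \<inter> \<beta> = {} then eta \<alpha> (insert v \<beta>) * c (insert v (\<alpha> \<union> \<beta>)) else 0)" for v
      using 1 by (auto simp: shift_def sub_def)
    show ?thesis
    proof (cases "\<alpha> \<inter> \<beta> = {}")
      case True
      have "ver (sub c) (\<alpha>, \<sigma>, \<beta>) = (\<Sum>v\<in>W - \<beta>. if v \<notin> \<alpha> then
          eps v \<beta> * (eta \<alpha> (insert v \<beta>) * c (insert v (\<alpha> \<union> \<beta>))) else 0)"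
        unfolding ver_def by (simp add: shift True if_distrib cong: if_cong)
      also have "\<dots> = (\<Sum>v\<in>W - (\<alpha> \<union> \<beta>). eps v \<beta> * (eta \<alpha> (insert v \<beta>) * c (insert v (\<alpha> \<union> \<beta>))))"
        using finite_W by (intro sum.mono_neutral_cong_right) auto
      also have "\<dots> = (\<Sum>v\<in>W - (\<alpha> \<union> \<beta>). eta \<alpha> \<beta> * (eps v (\<alpha> \<union> \<beta>) * c (insert v (\<alpha> \<union> \<beta>))))"
        using True by (intro sum.cong refl) (simp add: eta_insert_right eps_union mult_ac)
      also have "\<dots> = sub (bd c) (\<alpha>, \<sigma>, \<beta>)"
        using 1 True by (simp add: sub_def bd_def sum_distrib_left)
      finally show ?thesis using hor by (simp add: tot_def)
    next
      case False
      then have "ver (sub c) (\<alpha>, \<sigma>, \<beta>) = 0" by (simp add: ver_def shift)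
      then show ?thesis using hor False by (simp add: tot_def sub_def)
    qed
  next
    case (2 v)
    have "hor (sub c) (\<alpha>, \<sigma>, \<beta>) = sg \<beta> * (\<Sum>u\<in>W - \<alpha>. eps u \<alpha> * sub c (insert u \<alpha>, \<sigma>, \<beta>))"
      by (simp add: hor_def bd_def)
    also have "(\<Sum>u\<in>W - \<alpha>. eps u \<alpha> * sub c (insert u \<alpha>, \<sigma>, \<beta>)) =
        (\<Sum>u\<in>W - \<alpha>. if u = v then eps v \<alpha> * sub c (\<sigma>, \<sigma>, \<beta>) else 0)"
    proof (rule sum.cong[OF refl])
      fix u assume u: "u \<in> W - \<alpha>"
      show "eps u \<alpha> * sub c (insert u \<alpha>, \<sigma>, \<beta>) = (if u = v then eps v \<alpha> * sub c (\<sigma>, \<sigma>, \<beta>) else 0)"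
      proof (cases "u = v")
        case False
        then have "\<sigma> \<noteq> insert u \<alpha>" using u 2 by blast
        then show ?thesis using False by (simp add: sub_def)
      qed (simp add: 2)
    qed
    also have "sg \<beta> * \<dots> = (if v \<in> W then sg \<beta> * (eps v \<alpha> * sub c (\<sigma>, \<sigma>, \<beta>)) else 0)"
      using finite_W 2(1) by (subst sum.delta) auto
    finally have hor: "hor (sub c) (\<alpha>, \<sigma>, \<beta>) = \<dots>" .
    have "ver (sub c) (\<alpha>, \<sigma>, \<beta>) = (\<Sum>u\<in>W - \<beta>. eps u \<beta> * shift u (sub c) (\<alpha>, \<sigma>, insert u \<beta>))"
      by (simp add: ver_def)
    also have "\<dots> = (\<Sum>u\<in>W - \<beta>. if u = v then - (eps v \<beta> * sub c (\<alpha>, \<alpha>, insert v \<beta>)) else 0)"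
    proof (rule sum.cong[OF refl])
      fix u
      have 0: "sub c (\<alpha>, \<sigma>, b) = 0" for b using 2 by (auto simp: sub_def)
      show "eps u \<beta> * shift u (sub c) (\<alpha>, \<sigma>, insert u \<beta>) =
          (if u = v then - (eps v \<beta> * sub c (\<alpha>, \<alpha>, insert v \<beta>)) else 0)"
      proof (cases "u = v")
        case True
        have "\<sigma> - {v} = \<alpha>" "v \<in> \<sigma>" using 2 by auto
        then show ?thesis using True by (simp add: shift_def 0)
      next
        case False
        then have "\<sigma> - {u} \<noteq> \<alpha>" using 2 by blast
        then show ?thesis using False by (simp add: shift_def 0) (simp add: sub_def)
      qed
    qed
    also have "\<dots> = (if v \<in> W - \<beta> then - (eps v \<beta> * sub c (\<alpha>, \<alpha>, insert v \<beta>)) else 0)"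
      using finite_W by (subst sum.delta) auto
    finally have ver: "ver (sub c) (\<alpha>, \<sigma>, \<beta>) = \<dots>" .
    \<comment> \<open>The cell \<open>(\<sigma>, \<sigma>, \<beta>)\<close> through
      \<open>hor\<close> and the cell \<open>(\<alpha>, \<alpha>, insert v \<beta>)\<close> through
      \<open>ver\<close> contribute opposite values.\<close>
    have "hor (sub c) (\<alpha>, \<sigma>, \<beta>) + ver (sub c) (\<alpha>, \<sigma>, \<beta>) = 0"
    proof (cases "v \<in> W - \<beta> \<and> \<alpha> \<inter> \<beta> = {}")
      case True
      then have "sub c (\<sigma>, \<sigma>, \<beta>) = eta (insert v \<alpha>) \<beta> * c (insert v (\<alpha> \<union> \<beta>))"
        "sub c (\<alpha>, \<alpha>, insert v \<beta>) = eps v \<alpha> * eta \<alpha> \<beta> * c (insert v (\<alpha> \<union> \<beta>))"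
        using 2 by (auto simp: sub_def eta_insert_right)
      moreover have "sg \<beta> * (eps v \<alpha> * (eta (insert v \<alpha>) \<beta> * x)) =
          eps v \<beta> * (eps v \<alpha> * eta \<alpha> \<beta> * x)" for x :: 'k
      proof -
        have "sg \<beta> * (eps v \<alpha> * (eta (insert v \<alpha>) \<beta> * x)) =
            sg \<beta> * eta (insert v \<alpha>) \<beta> * (eps v \<alpha> * x)" by (simp only: mult_ac)
        also have "sg \<beta> * eta (insert v \<alpha>) \<beta> = (eps v \<beta> * eta \<alpha> \<beta> :: 'k)"
          using True 2(1) by (intro eta_insert_left) auto
        finally show ?thesis by (simp only: mult_ac)
      qed
      ultimately show ?thesis unfolding hor ver using True by simp
    next
      case False
      then show ?thesis unfolding hor ver using 2 by (auto simp: sub_def)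
    qed
    then show ?thesis using 2 by (auto simp: tot_def sub_def)
  next
    case 3
    have "sub c (insert v \<alpha>, \<sigma>, \<beta>) = 0" if "v \<in> W - \<alpha>" for v
      using that 3(2)[of v] by (auto simp: sub_def)
    then have "hor (sub c) (\<alpha>, \<sigma>, \<beta>) = 0" by (simp add: hor_def bd_def)
    moreover have "shift v (sub c) (\<alpha>, \<sigma>, insert v \<beta>) = 0" for v
      using 3 by (auto simp: shift_def sub_def insert_absorb)
    then have "ver (sub c) (\<alpha>, \<sigma>, \<beta>) = 0" by (simp add: ver_def)
    ultimately show ?thesis using 3(1) by (simp add: tot_def sub_def)
  qed
qed

section \<open>The projection that is left inverse to the embedding\<close>

definition aug :: "('v set \<times> 'v set \<times> 'v set \<Rightarrow> 'k::field) \<Rightarrow> 'v set \<Rightarrow> 'k" where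
  "aug f \<alpha> = (\<Sum>\<sigma>\<in>Pow W. f (\<alpha>, \<sigma>, {}))"

lemma aug_sub:
  assumes "c \<in> supported (Pow W)"
  shows "aug (sub c) = c"
proof
  fix \<alpha>
  have "aug (sub c) \<alpha> = (\<Sum>\<sigma>\<in>Pow W. if \<sigma> = \<alpha> then c \<alpha> else 0)"
    unfolding aug_def by (intro sum.cong refl) (auto simp: sub_def eta_def)
  also have "\<dots> = c \<alpha>"
    using finite_W supportedD[OF assms, of \<alpha>] by simp
  finally show "aug (sub c) \<alpha> = c \<alpha>" .
qed

text \<open>The two ends \<open>\<sigma>\<close> and \<open>insert v \<sigma>\<close> of an edge are
  projected to the same \<open>\<alpha>\<close>, so the vertical part cancels. The hypothesis holds
  for functions supported on \<open>cells\<close>, where \<open>\<sigma>\<close> and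
  \<open>\<beta>\<close> are disjoint.\<close>

lemma aug_tot:
  assumes "\<And>\<alpha> \<sigma> v. v \<in> \<sigma> \<Longrightarrow> f (\<alpha>, \<sigma>, {v}) = 0"
  shows "aug (tot f) = bd (aug f)"
proof
  fix \<alpha>
  have "(\<Sum>\<sigma>\<in>Pow W. shift v f (\<alpha>, \<sigma>, {v})) = 0" if v: "v \<in> W" for v
  proof -
    have "(\<Sum>\<sigma>\<in>Pow W. f (\<alpha>, \<sigma>, {v})) = (\<Sum>\<sigma>\<in>{\<sigma> \<in> Pow W. v \<notin> \<sigma>}. f (\<alpha>, \<sigma>, {v}))"
      using finite_W assms by (intro sum.mono_neutral_right) auto
    also have "\<dots> = (\<Sum>\<sigma>\<in>{\<sigma> \<in> Pow W. v \<in> \<sigma>}. f (\<alpha>, \<sigma> - {v}, {v}))"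
      using v by (intro sum.reindex_bij_witness[of _ "\<lambda>\<sigma>. \<sigma> - {v}" "insert v"]) auto
    also have "\<dots> = (\<Sum>\<sigma>\<in>Pow W. if v \<in> \<sigma> then f (\<alpha>, \<sigma> - {v}, {v}) else 0)"
      using finite_W by (intro sum.mono_neutral_cong_left) auto
    finally show ?thesis by (simp add: shift_def sum_subtractf)
  qed
  then have "(\<Sum>v\<in>W. \<Sum>\<sigma>\<in>Pow W. shift v f (\<alpha>, \<sigma>, {v})) = 0" by simp
  then have "(\<Sum>\<sigma>\<in>Pow W. ver f (\<alpha>, \<sigma>, {})) = 0"
    by (subst (asm) sum.swap) (simp add: ver_def eps_def)
  then have "aug (tot f) \<alpha> = (\<Sum>\<sigma>\<in>Pow W. bd (\<lambda>a. f (a, \<sigma>, {})) \<alpha>)"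
    by (simp add: aug_def tot_def sum.distrib hor_def sg_def)
  also have "\<dots> = bd (aug f) \<alpha>"
    unfolding bd_def aug_def by (subst sum.swap) (simp add: sum_distrib_left)
  finally show "aug (tot f) \<alpha> = bd (aug f) \<alpha>" .
qed

end

context two_complexes
begin

text \<open>The separating functionals are pulled back along \<open>sub\<close>. If they all vanish
  on a cycle \<open>c\<close>, then \<open>sub c = tot y\<close> for some \<open>y\<close>, and
  applying \<open>aug\<close> gives \<open>c = bd (aug y)\<close>.\<close>

lemma betti_intersection_le:
  "reduced_betti TYPE('k::field) (int k - 1) (X \<inter> Y)
    \<le> (\<Sum>\<sigma>\<in>Y. \<Sum>(i, j)\<in>{(i, j). i + j = k}.
          reduced_betti TYPE('k) (int i - 1) (induced_subcomplex X \<sigma>) *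
          reduced_betti TYPE('k) (int j - 1) (link Y \<sigma>))" (is "_ \<le> ?S")
proof -
  interpret I: complex_on W "X \<inter> Y"
    using X.vertices X.down_closed Y.down_closed by unfold_locales blast+
  have "up_closed Y" by (simp add: up_closed_def)
  from filtration_bound[OF this, of k, where 'k='k]
  obtain F :: "(('v set \<times> 'v set \<times> 'v set \<Rightarrow> 'k) \<Rightarrow> 'k) set" where F:
    "separates F {f \<in> supported (cells Y k). tot f = 0} (tot ` supported (cells Y (Suc k)))"
    "card F \<le> ?S"
    by blast
  have "separates ((\<lambda>\<phi> c. \<phi> (sub c)) ` F) (I.cyc k) (I.bds k)"
    unfolding separates_def
  proof (intro conjI ballI impI)
    show "finite ((\<lambda>\<phi> c. \<phi> (sub c)) ` F)" using F(1) by (simp add: separates_def)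
    show "functional \<phi>" if "\<phi> \<in> (\<lambda>\<phi> c. \<phi> (sub c)) ` F" for \<phi>
      using that F(1) by (auto simp: separates_def intro!: functional_comp[OF _ fun_linear_sub])
    fix c :: "'v set \<Rightarrow> 'k"
    assume "c \<in> I.cyc k" and zero: "\<forall>\<phi>\<in>(\<lambda>\<phi> c. \<phi> (sub c)) ` F. \<phi> c = 0"
    then have c: "c \<in> supported (faces k (X \<inter> Y))" "bd c = 0" by (auto simp: I.cyc_def)
    have "sub c \<in> supported (cells Y k)"
    proof (rule supportedI, clarify, rule ccontr)
      fix \<alpha> \<sigma> \<beta> assume *: "(\<alpha>, \<sigma>, \<beta>) \<notin> cells Y k" "sub c (\<alpha>, \<sigma>, \<beta>) \<noteq> 0"
      then have eq: "\<sigma> = \<alpha>" "\<alpha> \<inter> \<beta> = {}" and "c (\<alpha> \<union> \<beta>) \<noteq> 0"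
        by (auto simp: sub_def split: if_splits)
      then have "\<alpha> \<union> \<beta> \<in> X" "\<alpha> \<union> \<beta> \<in> Y" "card (\<alpha> \<union> \<beta>) = k"
        using c(1) by (auto simp: supported_def faces_def)
      moreover from this have "finite \<alpha>" "finite \<beta>" "\<alpha> \<in> X" "\<alpha> \<in> Y"
        using X.finite_face[of "\<alpha> \<union> \<beta>"] X.down_closed[of "\<alpha> \<union> \<beta>" \<alpha>] Y.down_closed[of "\<alpha> \<union> \<beta>" \<alpha>]
        by auto
      ultimately show False using * eq by (auto simp: cells_def card_Un_disjoint)
    qed
    moreover have "tot (sub c) = 0" using c(2) FP.linear_0[OF fun_linear_sub] by (simp add: tot_sub)
    ultimately have "sub c \<in> tot ` supported (cells Y (Suc k))"
      using F(1) zero unfolding separates_def ball_simps by blast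
    then obtain y where y: "y \<in> supported (cells Y (Suc k))" "sub c = tot y" by blast
    have "y (\<alpha>, \<sigma>, {v}) = 0" if "v \<in> \<sigma>" for \<alpha> \<sigma> v
      using that by (intro supportedD[OF y(1)]) (auto simp: cells_def)
    then have "bd (aug y) = aug (sub c)" unfolding y(2) by (rule aug_tot[symmetric])
    also have "\<dots> = c"
      using c(1) X.vertices by (intro aug_sub) (auto simp: supported_def faces_def)
    finally have "c = bd (aug y)" ..
    moreover have "aug y \<in> supported (faces (Suc k) (X \<inter> Y))"
    proof (rule supportedI)
      fix \<alpha> assume "\<alpha> \<notin> faces (Suc k) (X \<inter> Y)"
      \<comment> \<open>A cell \<open>(\<alpha>, \<sigma>, {})\<close> has
        \<open>\<alpha> \<in> X\<close> and \<open>\<alpha> \<subseteq> \<sigma> \<in> Y\<close>, so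
        its first entry is a face of the intersection.\<close>
      then have "(\<alpha>, \<sigma>, {}) \<notin> cells Y (Suc k)" for \<sigma>
        using Y.down_closed[of \<sigma> \<alpha>] by (auto simp: cells_def faces_def)
      then show "aug y \<alpha> = 0" by (simp add: aug_def supportedD[OF y(1)])
    qed
    ultimately show "c \<in> I.bds k" by (simp add: I.bds_def)
  qed
  then have "reduced_betti TYPE('k) (int k - 1) (X \<inter> Y) \<le> card ((\<lambda>\<phi> (c :: 'v set \<Rightarrow> 'k). \<phi> (sub c)) ` F)"
    by (rule I.reduced_betti_le_if_separates)
  also have "\<dots> \<le> card F" using F(1) by (intro card_image_le) (simp add: separates_def)
  also have "\<dots> \<le> ?S" by (rule F(2))
  finally show ?thesis .
qed

end

theorem theorem1p1:
  fixes V :: "'v set" and X Y :: "'v set set" and k :: nat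
  assumes "simplicial_complex V X" and "finite X"
    and "simplicial_complex V Y" and "finite Y"
  shows "reduced_betti TYPE('k::field) (int k - 1) (X \<inter> Y)
    \<le> (\<Sum>\<sigma>\<in>Y. \<Sum>(i, j)\<in>{(i, j). i + j = k}.
          reduced_betti TYPE('k) (int i - 1) (induced_subcomplex X \<sigma>) *
          reduced_betti TYPE('k) (int j - 1) (link Y \<sigma>))"
proof -
  \<comment> \<open>The ground set consists of the vertices that occur; it is finite even if
    \<open>V\<close> is not.\<close>
  interpret two_complexes "\<Union>X \<union> \<Union>Y" X Y
  proof
    show "finite (\<Union>X \<union> \<Union>Y)" using assms by (auto simp: simplicial_complex_def)
  qed (use assms in \<open>auto simp: simplicial_complex_def\<close>)
  show ?thesis by (rule betti_intersection_le)
qed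

end
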